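(* Let $\mathbb{X}$ be a quasi-Banach space and let $\emptyset\neq\mathscr{C}\subseteq\mathbb{X}$ satisfy Condition $(\zeta)$. Then there exists a Borel probability measure $\mu$ on $\mathbb{X}$ that is critical for $\mathscr{C}$ and satisfies $\mu^{\ast}(\mathbb{X}\setminus\mathscr{C})=0$ and $\mu^{\ast}(\mathscr{C})=1$. In particular, the power-exponential Hausdorff dimension of $\mathscr{C}$ coincides with its lower power-exponential Minkowski dimension: $$\dim_{H,\exp}(\mathscr{C})=\underline{\dim}_{\mathrm{M},\exp}(\mathscr{C}).$$
   Context: Quasi-norms. A quasi-norm on a real or complex vector space $\mathbb{X}$ is a definite, absolutely homogeneous map $\|\cdot\|:\mathbb{X}\to[0,\infty)$ with $\|x+y\|\le k(\|x\|+\|y\|)$ for some constant $k\ge1$ (a modulus of concavity). It induces the quasi-metric $d(x,y)=\|x-y\|$. A quasi-metric satisfies the metric axioms with the triangle inequality replaced by $d(x,z)\le k(d(x,y)+d(y,z))$. A set $U$ is open if for each $x\in U$ there is $r>0$ with $B(x,r):=\{y: d(x,y)\le r\}\subseteq U$; the Borel $\sigma$-algebra is generated by the open sets (balls need not be Borel). A quasi-Banach space is a complete quasi-normed space. Outer measure. For a measure $\mu$ on a $\sigma$-algebra $\mathcal{A}$ on $\mathbb{X}$ and arbitrary $M\subseteq\mathbb{X}$, $\mu^{\ast}(M):=\inf\{\mu(A): A\in\mathcal{A},\ A\supseteq M\}$. Condition $(\zeta)$. A set $\emptyset\ne\mathscr{C}\subseteq\mathbb{X}$ satisfies Condition $(\zeta)$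 if there are constants $C,\alpha>0$ such that for all $x_1,x_2,\ldots\in\mathscr{C}$ the series $\sum_{n=1}^\infty \frac{x_n}{C n^{\alpha}}$ converges in $\mathbb{X}$ to an element of $\mathscr{C}$. Minkowski dimension. The covering number $\mathcal{N}(\mathscr{C},\varepsilon)$ is the least $n\in\mathbb{N}$ such that $\mathscr{C}$ is covered by $n$ closed balls of radius $\varepsilon$ with centers in $\mathscr{C}$ ($\infty$ if there is none). If $\mathscr{C}$ is totally bounded with at least two elements, $$\underline{\dim}_{\mathrm{M},\exp}(\mathscr{C}):=\liminf_{\varepsilon\downarrow0}\frac{\log_2\log_2\mathcal{N}(\mathscr{C},\varepsilon)}{\log_2(1/\varepsilon)}\in[0,\infty].$$ It is set to $0$ if $\mathscr{C}$ has fewer than two elements, and to $\infty$ if $\mathscr{C}$ is not totally bounded. Small-ball condition and criticality. A measure $\mu$ on a $\sigma$-algebra on $\mathbb{X}$ satisfies the small-ball condition with parameter $s\ge0$ if there are $c,r_0>0$ (depending on $s$) with $\mu^{\ast}(B(x,r))\le\exp(-c\,(1/r)^s)$ for all $x\in\mathbb{X}$ and $0<r<r_0$. It is critical for $\mathscr{C}$ if $\mu^{\ast}(\mathscr{C})>0$ and it satisfies the small-ball condition with parameter $s$ for every $0<s<\underline{\dim}_{\mathrm{M},\exp}(\mathscr{C})$. Hausdorff dimension. For $s\in(0,\infty)$ let $f_s(r)=\exp(-(1/r)^s)$ for $r>0$ and $f_s(0)=0$. With $\operatorname{diam}(M)=\sup_{x,y\in M}d(x,y)$ and $\operatorname{diam}(\emptyset)=0$,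 set $$\mathcal{H}^s_{\exp}(M):=\sup_{\delta>0}\ \inf\Big\{\sum_{i=1}^\infty f_s(\operatorname{diam}(M_i)) : M_i\subseteq\mathbb{X},\ \bigcup_{i}M_i\supseteq M,\ \operatorname{diam}(M_i)\le\delta\Big\},$$ and $\dim_{H,\exp}(M):=\sup\{s\in(0,\infty):\mathcal{H}^s_{\exp}(M)=\infty\}$ with $\sup\emptyset=0$ (equivalently, $\inf\{s\in(0,\infty):\mathcal{H}^s_{\exp}(M)=0\}$ with $\inf\emptyset=\infty$). *)

theory Defs
  imports "HOL-Probability.Probability"
begin

text \<open>The space is a whole type. The scalars range over the class of real normed fields, whose
  only members, up to isometric isomorphism, are the real and the complex numbers (Gelfand--Mazur);
  a real number \<open>r\<close> acts as the scalar \<open>of_real r\<close>.\<close>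

locale quasi_normed_space = vector_space scl
  for scl :: "'k::real_normed_field \<Rightarrow> 'a::ab_group_add \<Rightarrow> 'a" +
  fixes qnorm :: "'a \<Rightarrow> real"
  assumes qnorm_nonneg: "0 \<le> qnorm x"
    and qnorm_eq_0_iff: "qnorm x = 0 \<longleftrightarrow> x = 0"
    and qnorm_scale: "qnorm (scl c x) = norm c * qnorm x"
    and qnorm_quasi_triangle: "\<exists>k\<ge>1. \<forall>x y. qnorm (x + y) \<le> k * (qnorm x + qnorm y)"

definition qdist :: "('a::ab_group_add \<Rightarrow> real) \<Rightarrow> 'a \<Rightarrow> 'a \<Rightarrow> real" where
  "qdist qnorm x y = qnorm (x - y)"

definition qconverges :: "('a \<Rightarrow> 'a \<Rightarrow> real) \<Rightarrow> (nat \<Rightarrow> 'a) \<Rightarrow> 'a \<Rightarrow> bool" where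
  "qconverges d u l \<longleftrightarrow> (\<lambda>n. d (u n) l) \<longlonglongrightarrow> 0"

definition qCauchy :: "('a \<Rightarrow> 'a \<Rightarrow> real) \<Rightarrow> (nat \<Rightarrow> 'a) \<Rightarrow> bool" where
  "qCauchy d u \<longleftrightarrow> (\<forall>e>0. \<exists>n0. \<forall>m\<ge>n0. \<forall>n\<ge>n0. d (u m) (u n) < e)"

definition qcomplete :: "('a \<Rightarrow> 'a \<Rightarrow> real) \<Rightarrow> bool" where
  "qcomplete d \<longleftrightarrow> (\<forall>u. qCauchy d u \<longrightarrow> (\<exists>l. qconverges d u l))"

locale quasi_banach_space = quasi_normed_space +
  assumes complete: "qcomplete (qdist qnorm)"

definition condition_zeta ::
  "('k::real_normed_field \<Rightarrow> 'a::ab_group_add \<Rightarrow> 'a) \<Rightarrow> ('a \<Rightarrow> real) \<Rightarrow> 'a set \<Rightarrow> bool" where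
  "condition_zeta scl qnorm S \<longleftrightarrow>
    (\<exists>C>0. \<exists>\<alpha>>0. \<forall>x. (\<forall>n\<ge>1. x n \<in> S) \<longrightarrow>
      (\<exists>l\<in>S. qconverges (qdist qnorm)
        (\<lambda>N. \<Sum>n=1..N. scl (of_real (1 / (C * real n powr \<alpha>))) (x n)) l))"

definition qball :: "('a \<Rightarrow> 'a \<Rightarrow> real) \<Rightarrow> 'a \<Rightarrow> real \<Rightarrow> 'a set" where
  "qball d x r = {y. d x y \<le> r}"

definition qopen :: "('a \<Rightarrow> 'a \<Rightarrow> real) \<Rightarrow> 'a set \<Rightarrow> bool" where
  "qopen d U \<longleftrightarrow> (\<forall>x\<in>U. \<exists>r>0. qball d x r \<subseteq> U)"

definition qborel :: "('a \<Rightarrow> 'a \<Rightarrow> real) \<Rightarrow> 'a measure" where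
  "qborel d = sigma UNIV {U. qopen d U}"

definition covering_number :: "('a \<Rightarrow> 'a \<Rightarrow> real) \<Rightarrow> 'a set \<Rightarrow> real \<Rightarrow> enat" where
  "covering_number d S \<epsilon> =
    (INF F \<in> {F. F \<subseteq> S \<and> finite F \<and> S \<subseteq> (\<Union>x\<in>F. qball d x \<epsilon>)}. enat (card F))"

definition qtotally_bounded :: "('a \<Rightarrow> 'a \<Rightarrow> real) \<Rightarrow> 'a set \<Rightarrow> bool" where
  "qtotally_bounded d S \<longleftrightarrow>
    (\<forall>\<epsilon>>0. \<exists>F. F \<subseteq> S \<and> finite F \<and> S \<subseteq> (\<Union>x\<in>F. qball d x \<epsilon>))"

text \<open>If \<open>S\<close> has at least two points, its covering number is at least 2 for all small \<open>\<epsilon>\<close>, so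
  the convention \<open>log 2 0 = 0\<close> does not affect the lower limit.\<close>

definition lower_minkowski_dim_exp :: "('a \<Rightarrow> 'a \<Rightarrow> real) \<Rightarrow> 'a set \<Rightarrow> ereal" where
  "lower_minkowski_dim_exp d S =
    (if finite S \<and> card S < 2 then 0
     else if \<not> qtotally_bounded d S then \<infinity>
     else Liminf (at_right 0)
       (\<lambda>\<epsilon>. ereal (log 2 (log 2 (real (the_enat (covering_number d S \<epsilon>)))) / log 2 (1 / \<epsilon>))))"

definition small_ball_condition ::
  "('a \<Rightarrow> 'a \<Rightarrow> real) \<Rightarrow> 'a measure \<Rightarrow> real \<Rightarrow> bool" where
  "small_ball_condition d \<mu> s \<longleftrightarrow>
    (\<exists>c>0. \<exists>r0>0. \<forall>x r. 0 < r \<and> r < r0 \<longrightarrow>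
      outer_measure_of \<mu> (qball d x r) \<le> ennreal (exp (- c * (1 / r) powr s)))"

definition critical_measure :: "('a \<Rightarrow> 'a \<Rightarrow> real) \<Rightarrow> 'a set \<Rightarrow> 'a measure \<Rightarrow> bool" where
  "critical_measure d S \<mu> \<longleftrightarrow>
    outer_measure_of \<mu> S > 0 \<and>
    (\<forall>s>0. ereal s < lower_minkowski_dim_exp d S \<longrightarrow> small_ball_condition d \<mu> s)"

definition qdiam :: "('a \<Rightarrow> 'a \<Rightarrow> real) \<Rightarrow> 'a set \<Rightarrow> ennreal" where
  "qdiam d M = (SUP (x, y) \<in> M \<times> M. ennreal (d x y))"

definition exp_gauge :: "real \<Rightarrow> real \<Rightarrow> real" where
  "exp_gauge s r = (if r = 0 then 0 else exp (- ((1 / r) powr s)))"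

text \<open>All diameters occurring below are at most \<open>\<delta> < \<infinity>\<close>, so \<^const>\<open>enn2real\<close> is exact on them.\<close>

definition hausdorff_measure_exp ::
  "('a \<Rightarrow> 'a \<Rightarrow> real) \<Rightarrow> real \<Rightarrow> 'a set \<Rightarrow> ennreal" where
  "hausdorff_measure_exp d s S =
    (SUP \<delta> \<in> {0::real<..}.
      INF M \<in> {M :: nat \<Rightarrow> 'a set. S \<subseteq> (\<Union>i. M i) \<and> (\<forall>i. qdiam d (M i) \<le> ennreal \<delta>)}.
        \<Sum>i. ennreal (exp_gauge s (enn2real (qdiam d (M i)))))"

text \<open>Inserting \<open>0\<close> realises the convention that the supremum of the empty set is \<open>0\<close>
  (in \<^typ>\<open>ereal\<close> it would be \<open>-\<infinity>\<close>).\<close>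

definition hausdorff_dim_exp :: "('a \<Rightarrow> 'a \<Rightarrow> real) \<Rightarrow> 'a set \<Rightarrow> ereal" where
  "hausdorff_dim_exp d S =
    Sup (insert 0 (ereal ` {s. 0 < s \<and> hausdorff_measure_exp d s S = \<infinity>}))"

end

theory Submission
  imports Defs "HOL-Real_Asymp.Real_Asymp"
begin

text \<open>Choose finite \<open>2 ^ -n\<close>-separated sets \<open>F n \<subseteq> S\<close> at least as large as the covering numbers of \<open>S\<close>
  at that scale, and let \<open>\<mu>\<close> be the law of the random series \<open>\<Sum>n. X\<^sub>n / (C n\<^sup>\<alpha>)\<close> with independent
  \<open>X\<^sub>n\<close>, uniform on \<open>F n\<close>. Condition \<open>(\<zeta>)\<close> makes the series converge surely, to a point of \<open>S\<close>, and a
  gluing argument makes the convergence uniform; hence the sum is a continuous function on a compact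
  product, so its range is a Borel subset of \<open>S\<close> that carries \<open>\<mu>\<close>. Freezing all coordinates but
  the \<open>n\<close>-th, at most one value of \<open>X\<^sub>n\<close> puts the sum into a given ball of radius about
  \<open>2 ^ -n / n\<^sup>\<alpha>\<close>, so that ball has measure at most \<open>1 / card (F n)\<close>; the factor \<open>n\<^sup>\<alpha>\<close> is only
  logarithmic in the radius, which is harmless for every exponent below the Minkowski dimension.
  The mass distribution principle then bounds the Hausdorff dimension from below.\<close>

section \<open>Quasi-metric spaces\<close>

locale quasi_metric =
  fixes d :: "'a \<Rightarrow> 'a \<Rightarrow> real" and k :: real
  assumes k_ge_1: "1 \<le> k"
    and nonneg: "0 \<le> d x y"
    and eq_0_iff: "d x y = 0 \<longleftrightarrow> x = y"
    and commute: "d x y = d y x"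
    and triangle: "d x z \<le> k * (d x y + d y z)"
begin

lemma k_pos: "0 < k"
  using k_ge_1 by simp

lemma d_self [simp]: "d x x = 0"
  by (simp add: eq_0_iff)

section \<open>Uniqueness of limits, closed sets and Borel hulls of balls\<close>

lemma qconverges_unique:
  assumes "qconverges d u l" "qconverges d u m"
  shows "l = m"
proof -
  have "(\<lambda>n. k * (d (u n) l + d (u n) m)) \<longlonglongrightarrow> k * (0 + 0)"
    using assms unfolding qconverges_def by (intro tendsto_intros)
  moreover have "d l m \<le> k * (d (u n) l + d (u n) m)" for n
    using triangle[of l m "u n"] by (simp add: commute)
  ultimately have "d l m \<le> k * (0 + 0)"
    by (intro LIMSEQ_le_const) auto
  then show ?thesis
    using nonneg[of l m] eq_0_iff[of l m] by simp
qed

lemma qopen_Compl_if_seq_closed: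
  assumes "\<And>u l. (\<And>n. u n \<in> K) \<Longrightarrow> qconverges d u l \<Longrightarrow> l \<in> K"
  shows "qopen d (- K)"
  unfolding qopen_def
proof (intro ballI, rule ccontr)
  fix x assume x: "x \<in> - K" and "\<not> (\<exists>r>0. qball d x r \<subseteq> - K)"
  then have "\<exists>y. y \<in> K \<and> d x y \<le> inverse (real (Suc n))" for n
    by (auto simp: qball_def subset_iff dest!: spec[of _ "inverse (real (Suc n))"])
  then obtain u where u: "\<And>n. u n \<in> K" "\<And>n. d x (u n) \<le> inverse (real (Suc n))"
    by metis
  have "qconverges d u x"
    unfolding qconverges_def
    by (rule tendsto_sandwich[OF _ _ tendsto_const LIMSEQ_inverse_real_of_nat])
      (use u(2) in \<open>simp_all add: nonneg commute[of _ x]\<close>)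
  with assms u(1) x show False
    by blast
qed

text \<open>The complemented set is the closure of \<open>M\<close>. A limit of its points is again
  approximated by points of \<open>M\<close>, at the cost of a factor from the quasi-triangle
  inequality.\<close>

lemma qopen_Compl_closure: "qopen d (- {z. \<forall>\<epsilon>>0. \<exists>y\<in>M. d z y \<le> \<epsilon>})"
proof (rule qopen_Compl_if_seq_closed, intro CollectI allI impI)
  fix u l and \<epsilon> :: real
  assume u: "\<And>n. u n \<in> {z. \<forall>\<epsilon>>0. \<exists>y\<in>M. d z y \<le> \<epsilon>}" and lim: "qconverges d u l" and "0 < \<epsilon>"
  define \<eta> where "\<eta> = \<epsilon> / (2 * k)"
  have "0 < \<eta>"
    using \<open>0 < \<epsilon>\<close> k_pos by (simp add: \<eta>_def)
  then have "\<forall>\<^sub>F n in sequentially. d (u n) l < \<eta>"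
    using lim unfolding qconverges_def by (intro order_tendstoD) auto
  then obtain n where n: "d (u n) l < \<eta>"
    by (auto simp: eventually_sequentially)
  obtain y where y: "y \<in> M" "d (u n) y \<le> \<eta>"
    using u[of n] \<open>0 < \<eta>\<close> by blast
  have "d l y \<le> k * (d l (u n) + d (u n) y)"
    by (rule triangle)
  also have "\<dots> \<le> k * (\<eta> + \<eta>)"
    using n y k_pos by (intro mult_left_mono add_mono) (auto simp: commute)
  also have "\<dots> = \<epsilon>"
    using k_pos by (simp add: \<eta>_def)
  finally show "\<exists>y\<in>M. d l y \<le> \<epsilon>"
    using y(1) by blast
qed

lemma qopen_sets_qborel: "qopen d U \<Longrightarrow> U \<in> sets (qborel d)"
  unfolding qborel_def by (intro in_measure_of) auto

lemma space_qborel: "space (qborel d) = UNIV"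
  by (simp add: qborel_def space_measure_of_conv)

text \<open>Balls need not be Borel.\<close>

lemma qball_borel_hull:
  assumes "0 < r"
  obtains A where "A \<in> sets (qborel d)" "qball d x r \<subseteq> A" "A \<subseteq> qball d x (2 * k * r)"
proof
  \<comment> \<open>The closure of the ball. It is Borel because its complement is open, and the
    choice \<open>\<epsilon> = r\<close> in its definition puts each of its points within
    \<open>r\<close> of the ball, whence the radius \<open>2 * k * r\<close>.\<close>
  let ?A = "{z. \<forall>\<epsilon>>0. \<exists>y\<in>qball d x r. d z y \<le> \<epsilon>}"
  have "- ?A \<in> sets (qborel d)"
    by (intro qopen_sets_qborel qopen_Compl_closure)
  then have "space (qborel d) - (- ?A) \<in> sets (qborel d)"
    by blast
  then show "?A \<in> sets (qborel d)"
    by (simp add: space_qborel double_complement flip: Compl_eq_Diff_UNIV)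
  show "qball d x r \<subseteq> ?A"
    by (force intro: less_imp_le)
  show "?A \<subseteq> qball d x (2 * k * r)"
  proof
    fix z assume "z \<in> ?A"
    then obtain y where y: "d x y \<le> r" "d z y \<le> r"
      using assms by (auto simp: qball_def)
    have "d x z \<le> k * (d x y + d y z)"
      by (rule triangle)
    also have "\<dots> \<le> k * (r + r)"
      using y k_pos by (intro mult_left_mono add_mono) (auto simp: commute)
    finally show "z \<in> qball d x (2 * k * r)"
      by (simp add: qball_def)
  qed
qed

section \<open>Separated sets, covering numbers and their growth\<close>

definition separated :: "real \<Rightarrow> 'a set \<Rightarrow> bool" where
  "separated \<epsilon> F \<longleftrightarrow> (\<forall>x\<in>F. \<forall>y\<in>F. x \<noteq> y \<longrightarrow> \<epsilon> < d x y)"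

text \<open>A finite separated set that does not cover can be enlarged by any uncovered point.
  Either this stops at a maximal set, which covers, or it produces separated sets of every
  size.\<close>

lemma separated_cover_or_large:
  assumes "S \<noteq> {}" "0 < \<epsilon>"
  shows "(\<forall>m. \<exists>F. F \<subseteq> S \<and> finite F \<and> separated \<epsilon> F \<and> card F = Suc m) \<or>
    (\<exists>F. F \<subseteq> S \<and> finite F \<and> F \<noteq> {} \<and> separated \<epsilon> F \<and> S \<subseteq> (\<Union>x\<in>F. qball d x \<epsilon>))"
proof (rule disjCI)
  assume no_cover: "\<not> (\<exists>F. F \<subseteq> S \<and> finite F \<and> F \<noteq> {} \<and> separated \<epsilon> F \<and> S \<subseteq> (\<Union>x\<in>F. qball d x \<epsilon>))"
  show "\<forall>m. \<exists>F. F \<subseteq> S \<and> finite F \<and> separated \<epsilon> F \<and> card F = Suc m"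
  proof
    fix m show "\<exists>F. F \<subseteq> S \<and> finite F \<and> separated \<epsilon> F \<and> card F = Suc m"
    proof (induction m)
      case 0
      obtain x where "x \<in> S"
        using assms by blast
      then show ?case
        by (intro exI[of _ "{x}"]) (auto simp: separated_def)
    next
      case (Suc m)
      then obtain F where F: "F \<subseteq> S" "finite F" "separated \<epsilon> F" "card F = Suc m"
        by blast
      with no_cover obtain z where z: "z \<in> S" "z \<notin> (\<Union>x\<in>F. qball d x \<epsilon>)"
        by (metis card.empty nat.distinct(1) subsetI)
      have "z \<notin> F"
        using z assms(2) eq_0_iff[of z z] by (auto simp: qball_def)
      moreover have "separated \<epsilon> (insert z F)"
        using F(3) z(2) by (auto simp: separated_def qball_def commute[of z])
      ultimately show ?case
        using F z(1) by (intro exI[of _ "insert z F"]) auto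
    qed
  qed
qed

text \<open>The alternative handles sets that are not totally bounded at scale \<open>2 ^ -n\<close>; the bound
  \<open>2 ^ 2 ^ n\<^sup>2\<close> then beats every power-exponential rate.\<close>

lemma separated_sequence:
  assumes "S \<noteq> {}"
  obtains F where
    "\<And>n. F n \<subseteq> S" "\<And>n. finite (F n)" "\<And>n. F n \<noteq> {}" "\<And>n. separated ((1/2) ^ n) (F n)"
    "\<And>n. S \<subseteq> (\<Union>x\<in>F n. qball d x ((1/2) ^ n)) \<or> 2 ^ 2 ^ n\<^sup>2 \<le> card (F n)"
proof -
  have "\<exists>F. F \<subseteq> S \<and> finite F \<and> F \<noteq> {} \<and> separated ((1/2) ^ n) F \<and>
      (S \<subseteq> (\<Union>x\<in>F. qball d x ((1/2) ^ n)) \<or> 2 ^ 2 ^ n\<^sup>2 \<le> card F)" (is "\<exists>F. ?P n F") for n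
    using separated_cover_or_large[OF assms, of "(1/2) ^ n"]
  proof
    assume "\<forall>m. \<exists>F. F \<subseteq> S \<and> finite F \<and> separated ((1/2) ^ n) F \<and> card F = Suc m"
    \<comment> \<open>The alternative supplies cardinalities of the form \<open>Suc m\<close>; with
      \<open>m = 2 ^ 2 ^ n\<^sup>2\<close> there is one point more than required.\<close>
    then obtain F where F: "F \<subseteq> S" "finite F" "separated ((1/2) ^ n) F" "card F = Suc (2 ^ 2 ^ n\<^sup>2)"
      by blast
    moreover from F(4) have "F \<noteq> {}"
      by force
    ultimately show ?thesis
      by (intro exI[of _ F]) auto
  qed auto
  then have "\<forall>n. \<exists>F. ?P n F"
    by blast
  from choice[OF this] obtain F where "\<forall>n. ?P n (F n)" ..
  then show ?thesis
    using that[of F] by blast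
qed

lemma covering_number_le_card:
  assumes "F \<subseteq> S" "finite F" "S \<subseteq> (\<Union>x\<in>F. qball d x \<epsilon>)"
  shows "covering_number d S \<epsilon> \<le> enat (card F)"
  unfolding covering_number_def using assms by (intro INF_lower) auto

text \<open>Total boundedness provides at least one cover, and a nonempty set of extended naturals
  contains its infimum.\<close>

lemma covering_number_attained:
  assumes "qtotally_bounded d S" "0 < \<epsilon>"
  obtains F where "F \<subseteq> S" "finite F" "S \<subseteq> (\<Union>x\<in>F. qball d x \<epsilon>)"
    "covering_number d S \<epsilon> = enat (card F)"
proof -
  let ?\<F> = "{F. F \<subseteq> S \<and> finite F \<and> S \<subseteq> (\<Union>x\<in>F. qball d x \<epsilon>)}"
  obtain F where "F \<in> ?\<F>"
    using assms by (auto simp: qtotally_bounded_def)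
  then have "enat (card F) \<in> (\<lambda>F. enat (card F)) ` ?\<F>"
    by (rule imageI)
  from wellorder_InfI[OF this] have "covering_number d S \<epsilon> \<in> (\<lambda>F. enat (card F)) ` ?\<F>"
    by (simp only: covering_number_def)
  then show ?thesis
    using that by auto
qed

text \<open>Undoes the two logarithms in the quotient that defines the dimension. The delicate point
  is that the inner logarithm must be positive for the outer one to be meaningful.\<close>

lemma minkowski_rate_less:
  fixes N :: nat and s \<epsilon> :: real
  assumes "0 < s" "0 < \<epsilon>" "\<epsilon> < 1" "1 \<le> N"
    and "s < log 2 (log 2 (real N)) / log 2 (1 / \<epsilon>)"
  shows "2 powr ((1 / \<epsilon>) powr s) < real N"
proof -
  have L: "0 < log 2 (1 / \<epsilon>)"
    using assms by simp
  then have *: "s * log 2 (1 / \<epsilon>) < log 2 (log 2 (real N))"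
    using assms(5) by (simp add: pos_less_divide_eq)
  moreover have "0 < s * log 2 (1 / \<epsilon>)"
    using L assms(1) by simp
  \<comment> \<open>Otherwise the outer logarithm would take the default value
    \<open>log 2 0 = 0\<close>, although it exceeds a positive number.\<close>
  ultimately have "log 2 (real N) \<noteq> 0"
    by (auto simp: log_def)
  moreover have "0 \<le> log 2 (real N)"
    using assms(4) by simp
  ultimately have "0 < log 2 (real N)"
    by simp
  have "log 2 ((1 / \<epsilon>) powr s) < log 2 (log 2 (real N))"
    using * assms by (simp add: log_powr)
  then have "(1 / \<epsilon>) powr s < log 2 (real N)"
    using \<open>0 < log 2 (real N)\<close> assms by (subst (asm) log_less_cancel_iff) auto
  then show ?thesis
    using assms by (subst (asm) less_log_iff) auto
qed

text \<open>The counterpart for upper bounds of the quotient. The case \<open>N = 1\<close>, where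
  the outer logarithm has its default value, is trivial because the right-hand side is at least
  1.\<close>

lemma minkowski_rate_greater:
  fixes N :: nat and s \<epsilon> :: real
  assumes "0 < \<epsilon>" "\<epsilon> < 1" "1 \<le> N"
    and "log 2 (log 2 (real N)) / log 2 (1 / \<epsilon>) < s"
  shows "real N \<le> 2 powr ((1 / \<epsilon>) powr s)"
proof (cases "N = 1")
  case False
  then have N: "0 < log 2 (real N)"
    using assms by simp
  have "log 2 (log 2 (real N)) < s * log 2 (1 / \<epsilon>)"
    using assms by (simp add: pos_divide_less_eq)
  also have "\<dots> = log 2 ((1 / \<epsilon>) powr s)"
    using assms by (simp add: log_powr)
  finally have "log 2 (real N) < (1 / \<epsilon>) powr s"
    using N assms by (subst (asm) log_less_cancel_iff) auto
  then show ?thesis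
    using assms by (subst (asm) log_less_iff) auto
qed (auto intro: ge_one_powr_ge_zero)

text \<open>If \<open>F n\<close> covers, it has at least as many points as the covering number,
  which grows at this rate below the Minkowski dimension. If it does not cover, it is huge by
  construction; for a set that is not totally bounded this is eventually always so.\<close>

lemma separated_sequence_card:
  assumes "S \<noteq> {}" "0 < s" "ereal s < lower_minkowski_dim_exp d S"
    and F: "\<And>n. F n \<subseteq> S" "\<And>n. finite (F n)"
      "\<And>n. S \<subseteq> (\<Union>x\<in>F n. qball d x ((1/2) ^ n)) \<or> 2 ^ 2 ^ n\<^sup>2 \<le> card (F n)"
  shows "\<forall>\<^sub>F n in sequentially. 2 powr (2 powr (real n * s)) \<le> real (card (F n))"
proof -
  have big: "\<forall>\<^sub>F n in sequentially.
      2 ^ 2 ^ n\<^sup>2 \<le> card (F n) \<longrightarrow> 2 powr (2 powr (real n * s)) \<le> real (card (F n))"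
    \<comment> \<open>From \<open>n \<ge> s\<close> on, \<open>n * s\<close> is at most
      \<open>n\<^sup>2\<close>.\<close>
    using eventually_ge_at_top[of "nat \<lceil>s\<rceil>"]
  proof eventually_elim
    case (elim n)
    show ?case
    proof
      assume large: "2 ^ 2 ^ n\<^sup>2 \<le> card (F n)"
      have "real n * s \<le> real (n\<^sup>2)"
        using elim by (simp add: power2_eq_square mult_left_mono)
      then have "2 powr (2 powr (real n * s)) \<le> 2 powr (2 powr (real (n\<^sup>2)))"
        by (intro powr_mono) auto
      also have "2 powr (real (n\<^sup>2)) = real (2 ^ n\<^sup>2)"
        by (subst powr_realpow) auto
      also have "2 powr \<dots> = real (2 ^ 2 ^ n\<^sup>2)"
        by (subst powr_realpow) auto
      also have "\<dots> \<le> real (card (F n))"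
        using large by (simp only: of_nat_le_iff)
      finally show "2 powr (2 powr (real n * s)) \<le> real (card (F n))" .
    qed
  qed
  have nontriv: "\<not> (finite S \<and> card S < 2)"
    using assms by (auto simp: lower_minkowski_dim_exp_def simp flip: zero_ereal_def)
  have null: "filterlim (\<lambda>n. (1/2) ^ n :: real) (at_right 0) sequentially"
    unfolding filterlim_at
    by (intro conjI always_eventually LIMSEQ_power_zero) auto
  show ?thesis
  proof (cases "qtotally_bounded d S")
    case False
    then obtain \<epsilon> where \<epsilon>: "0 < \<epsilon>" "\<And>F. F \<subseteq> S \<Longrightarrow> finite F \<Longrightarrow> \<not> S \<subseteq> (\<Union>x\<in>F. qball d x \<epsilon>)"
      by (auto simp: qtotally_bounded_def)
    have "\<forall>\<^sub>F n in sequentially. (1/2) ^ n < \<epsilon>"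
      using \<epsilon>(1) by (intro order_tendstoD(2)[OF LIMSEQ_power_zero]) auto
    with big show ?thesis
    proof eventually_elim
      case (elim n)
      have "\<not> S \<subseteq> (\<Union>x\<in>F n. qball d x ((1/2) ^ n))"
        using \<epsilon>(2)[OF F(1,2)[of n]] elim by (fastforce simp: qball_def)
      then show ?case
        using F(3)[of n] elim by blast
    qed
  next
    case True
    have "ereal s < Liminf (at_right 0)
       (\<lambda>\<epsilon>. ereal (log 2 (log 2 (real (the_enat (covering_number d S \<epsilon>)))) / log 2 (1 / \<epsilon>)))"
      using assms(3) True nontriv by (simp add: lower_minkowski_dim_exp_def)
    then have "\<forall>\<^sub>F \<epsilon> in at_right 0.
      s < log 2 (log 2 (real (the_enat (covering_number d S \<epsilon>)))) / log 2 (1 / \<epsilon>)"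
      by (auto dest!: less_LiminfD)
    moreover have "\<forall>\<^sub>F \<epsilon>::real in at_right 0. 0 < \<epsilon> \<and> \<epsilon> < 1"
      by (auto simp: eventually_at_right_field intro!: exI[of _ 1])
    \<comment> \<open>Stated for all finite covers at scale \<open>\<epsilon>\<close>, the bound can
      be pulled back along \<open>(1/2) ^ n\<close> and then applied to \<open>F n\<close>.\<close>
    ultimately have "\<forall>\<^sub>F \<epsilon> in at_right 0.
      \<forall>F. F \<subseteq> S \<longrightarrow> finite F \<longrightarrow> S \<subseteq> (\<Union>x\<in>F. qball d x \<epsilon>) \<longrightarrow>
        2 powr ((1 / \<epsilon>) powr s) \<le> real (card F)"
    proof eventually_elim
      case (elim \<epsilon>)
      then have \<epsilon>: "0 < \<epsilon>" "\<epsilon> < 1"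
        by auto
      obtain G where G: "finite G" "S \<subseteq> (\<Union>x\<in>G. qball d x \<epsilon>)"
          "covering_number d S \<epsilon> = enat (card G)"
        using covering_number_attained[OF True \<epsilon>(1)] .
      from G assms(1) have "1 \<le> card G"
        by (auto simp: Suc_le_eq card_gt_0_iff)
      then have less: "2 powr ((1 / \<epsilon>) powr s) < real (card G)"
        using elim(1) \<epsilon> assms(2) by (intro minkowski_rate_less) (auto simp: G(3))
      have "card G \<le> card F" if "F \<subseteq> S" "finite F" "S \<subseteq> (\<Union>x\<in>F. qball d x \<epsilon>)" for F
        using covering_number_le_card[OF that] by (simp add: G(3))
      with less show ?case
        by (meson less_le_trans less_imp_le of_nat_le_iff)
    qed
    then have "\<forall>\<^sub>F n in sequentially. \<forall>F. F \<subseteq> S \<longrightarrow> finite F \<longrightarrow>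
        S \<subseteq> (\<Union>x\<in>F. qball d x ((1/2) ^ n)) \<longrightarrow> 2 powr ((1 / (1/2) ^ n) powr s) \<le> real (card F)"
      by (rule eventually_compose_filterlim[OF _ null])
    with big show ?thesis
    proof eventually_elim
      case (elim n)
      have "(1 / (1/2) ^ n) powr s = (2::real) powr (real n * s)"
        by (simp add: power_one_over powr_powr flip: powr_realpow)
      then show ?case
        using F[of n] elim by auto
    qed
  qed
qed

end

section \<open>Power-exponential Hausdorff dimension\<close>

text \<open>The quotient of the two powers is \<open>\<epsilon> powr (s - t)\<close>, which tends to
  0. This absorbs constant factors whenever an exponent is lowered; with \<open>t = 0\<close> it
  compares a constant with a power.\<close>

lemma eventually_powr_dominated:
  fixes s t A B :: real
  assumes "t < s" "0 < B"
  shows "\<forall>\<^sub>F \<epsilon> in at_right 0. A * (1 / \<epsilon>) powr t \<le> B * (1 / \<epsilon>) powr s"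
proof -
  have "((\<lambda>\<epsilon>. \<epsilon> powr (s - t)) \<longlongrightarrow> (0::real)) (at_right 0)"
    using assms by (intro tendsto_zero_powrI[of _ _ _ "s - t"])
      (auto simp: eventually_at_right_field intro: tendsto_ident_at exI[of _ 1])
  then have "((\<lambda>\<epsilon>. A * \<epsilon> powr (s - t)) \<longlongrightarrow> (0::real)) (at_right 0)"
    by (rule tendsto_mult_right_zero)
  then have "\<forall>\<^sub>F \<epsilon> in at_right 0. A * \<epsilon> powr (s - t) < B"
    using assms by (intro order_tendstoD)
  moreover have "\<forall>\<^sub>F \<epsilon>::real in at_right 0. 0 < \<epsilon>"
    by (rule eventually_at_right_less)
  ultimately show ?thesis
  proof eventually_elim
    case (elim \<epsilon>)
    have "A * (1 / \<epsilon>) powr t = (A * \<epsilon> powr (s - t)) * (1 / \<epsilon>) powr s"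
      using elim by (simp add: powr_diff powr_divide field_simps)
    also have "\<dots> \<le> B * (1 / \<epsilon>) powr s"
      using elim by (intro mult_right_mono) auto
    finally show ?case .
  qed
qed

text \<open>Each set has a measurable hull of the same measure, and countable subadditivity holds
  for the hulls.\<close>

lemma outer_measure_of_UN_le:
  fixes M :: "nat \<Rightarrow> 'a set"
  assumes "\<And>i. M i \<subseteq> space \<mu>"
  shows "outer_measure_of \<mu> (\<Union>i. M i) \<le> (\<Sum>i. outer_measure_of \<mu> (M i))"
proof -
  have "\<exists>E\<in>sets \<mu>. M i \<subseteq> E \<and> outer_measure_of \<mu> (M i) = emeasure \<mu> E" for i
    using assms by (rule outer_measure_of_attain)
  then obtain E where E: "\<And>i. E i \<in> sets \<mu>" "\<And>i. M i \<subseteq> E i"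
      "\<And>i. outer_measure_of \<mu> (M i) = emeasure \<mu> (E i)"
    by metis
  have "outer_measure_of \<mu> (\<Union>i. M i) \<le> outer_measure_of \<mu> (\<Union>i. E i)"
    using E(2) by (intro outer_measure_of_mono) blast
  also have "\<dots> = emeasure \<mu> (\<Union>i. E i)"
    using E(1) by (intro outer_measure_of_eq) auto
  also have "\<dots> \<le> (\<Sum>i. emeasure \<mu> (E i))"
    using E(1) by (intro emeasure_subadditive_countably) auto
  finally show ?thesis
    by (simp add: E(3))
qed

lemma exp_gauge_le:
  assumes "0 < s" "0 \<le> a" "a \<le> b" "0 < b"
  shows "exp_gauge s a \<le> exp (- ((1 / b) powr s))"
  using assms by (auto simp: exp_gauge_def intro!: powr_mono2 divide_left_mono)

section \<open>Upper bound of the Hausdorff dimension by the Minkowski dimension\<close>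

context quasi_metric
begin

lemma lower_minkowski_dim_exp_nonneg:
  assumes "S \<noteq> {}"
  shows "0 \<le> lower_minkowski_dim_exp d S"
proof -
  have "0 \<le> Liminf (at_right 0) (\<lambda>\<epsilon>.
      ereal (log 2 (log 2 (real (the_enat (covering_number d S \<epsilon>)))) / log 2 (1 / \<epsilon>)))"
  proof (rule Liminf_bounded)
    have "\<forall>\<^sub>F \<epsilon>::real in at_right 0. 0 < \<epsilon> \<and> \<epsilon> < 1"
      by (auto simp: eventually_at_right_field intro!: exI[of _ 1])
    then show "\<forall>\<^sub>F \<epsilon> in at_right 0.
      0 \<le> ereal (log 2 (log 2 (real (the_enat (covering_number d S \<epsilon>)))) / log 2 (1 / \<epsilon>))"
    proof eventually_elim
      case (elim \<epsilon>)
      have "0 \<le> log 2 (log 2 (real n))" for n :: nat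
      proof (cases "n < 2")
        case True
        \<comment> \<open>In both cases the outer logarithm is \<open>log 2 0\<close>, which is 0 by
          convention.\<close>
        then have "n = 0 \<or> n = 1"
          by auto
        then show ?thesis
          by (auto simp: log_def)
      next
        case False
        then have "log 2 2 \<le> log 2 (real n)"
          by (subst log_le_cancel_iff) auto
        then show ?thesis
          by simp
      qed
      then show ?case
        using elim by (simp add: zero_le_divide_iff)
    qed
  qed
  then show ?thesis
    by (simp add: lower_minkowski_dim_exp_def)
qed

lemma qdiam_qball_le: "qdiam d (qball d x \<epsilon>) \<le> ennreal (2 * k * \<epsilon>)"
  unfolding qdiam_def
proof (rule SUP_least, clarify, rule ennreal_leI)
  fix y z assume "y \<in> qball d x \<epsilon>" "z \<in> qball d x \<epsilon>"
  then have "k * (d y x + d x z) \<le> k * (\<epsilon> + \<epsilon>)"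
    using k_pos by (intro mult_left_mono add_mono) (auto simp: qball_def commute)
  then show "d y z \<le> 2 * k * \<epsilon>"
    using triangle[of y z x] by simp
qed

text \<open>A lower limit below \<open>t\<close> gives arbitrarily small \<open>\<epsilon>\<close>
  at which at most \<open>2 powr ((1 / \<epsilon>) powr t)\<close> balls suffice. Each has diameter
  at most \<open>2 * k * \<epsilon>\<close>, and since \<open>s > t\<close> its gauge is eventually
  smaller than the reciprocal of that number. Finiteness of the measure is what the dimension bound
  uses.\<close>

lemma hausdorff_measure_exp_le_1:
  assumes "0 < s" "0 < t" "t < s" "lower_minkowski_dim_exp d S < ereal t" "S \<noteq> {}"
  shows "hausdorff_measure_exp d s S \<le> 1"
  unfolding hausdorff_measure_exp_def
proof (rule SUP_least)
  fix \<delta> :: real assume "\<delta> \<in> {0<..}"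
  then have "0 < \<delta>"
    by simp
  have "\<exists>M. S \<subseteq> (\<Union>i. M i) \<and> (\<forall>i::nat. qdiam d (M i) \<le> ennreal \<delta>) \<and>
    (\<Sum>i. ennreal (exp_gauge s (enn2real (qdiam d (M i))))) \<le> 1"
  proof (cases "finite S \<and> card S < 2")
    case True
    then have "card S = 1"
      using assms(5) by (metis One_nat_def Suc_1 card_0_eq less_2_cases)
    then obtain x where "S = {x}"
      by (auto simp: card_1_singleton_iff)
    then have "qdiam d S = 0"
      by (simp add: qdiam_def)
    then show ?thesis
      by (intro exI[of _ "\<lambda>_. S"]) (auto simp: exp_gauge_def)
  next
    case False
    then have tb: "qtotally_bounded d S"
      using assms(4) by (auto simp: lower_minkowski_dim_exp_def split: if_splits)
    have "\<not> (\<forall>\<^sub>F \<epsilon> in at_right 0.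
      ereal t \<le> ereal (log 2 (log 2 (real (the_enat (covering_number d S \<epsilon>)))) / log 2 (1 / \<epsilon>)))"
    proof
      assume "\<forall>\<^sub>F \<epsilon> in at_right 0.
        ereal t \<le> ereal (log 2 (log 2 (real (the_enat (covering_number d S \<epsilon>)))) / log 2 (1 / \<epsilon>))"
      from Liminf_bounded[OF this] assms(4) False tb have False
        by (simp add: lower_minkowski_dim_exp_def)
      then show False .
    qed
    then have often: "\<exists>\<^sub>F \<epsilon> in at_right 0.
      log 2 (log 2 (real (the_enat (covering_number d S \<epsilon>)))) / log 2 (1 / \<epsilon>) < t"
      by (simp add: frequently_def not_less)
    have small: "\<forall>\<^sub>F \<epsilon>::real in at_right 0. 0 < \<epsilon> \<and> \<epsilon> < 1 \<and> \<epsilon> < \<delta> / (2 * k)"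
      using \<open>0 < \<delta>\<close> k_pos
      by (auto simp: eventually_at_right_field intro!: exI[of _ "min 1 (\<delta> / (2 * k))"])
    \<comment> \<open>The factor \<open>ln 2\<close> passes from base 2 to the exponential function;
      the factor on the right comes from the diameter bound
      \<open>2 * k * \<epsilon>\<close>.\<close>
    have dominated: "\<forall>\<^sub>F \<epsilon>::real in at_right 0.
        ln 2 * (1 / \<epsilon>) powr t \<le> (1 / (2 * k)) powr s * (1 / \<epsilon>) powr s"
      using assms k_pos by (intro eventually_powr_dominated) auto
    have "\<exists>\<^sub>F \<epsilon> in at_right 0.
       log 2 (log 2 (real (the_enat (covering_number d S \<epsilon>)))) / log 2 (1 / \<epsilon>) < t \<and>
       (0 < \<epsilon> \<and> \<epsilon> < 1 \<and> \<epsilon> < \<delta> / (2 * k)) \<and>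
       ln 2 * (1 / \<epsilon>) powr t \<le> (1 / (2 * k)) powr s * (1 / \<epsilon>) powr s"
      using often eventually_conj[OF small dominated] by (rule frequently_eventually_frequently)
    then obtain \<epsilon> where \<epsilon>:
        "log 2 (log 2 (real (the_enat (covering_number d S \<epsilon>)))) / log 2 (1 / \<epsilon>) < t"
        "0 < \<epsilon>" "\<epsilon> < 1" "\<epsilon> < \<delta> / (2 * k)"
        "ln 2 * (1 / \<epsilon>) powr t \<le> (1 / (2 * k)) powr s * (1 / \<epsilon>) powr s"
      using frequently_ex by blast
    obtain G where G: "finite G" "S \<subseteq> (\<Union>x\<in>G. qball d x \<epsilon>)"
          "covering_number d S \<epsilon> = enat (card G)"
      using covering_number_attained[OF tb \<epsilon>(2)] .
    from G assms(5) have "1 \<le> card G"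
      by (auto simp: Suc_le_eq card_gt_0_iff)
    then have card: "real (card G) \<le> 2 powr ((1 / \<epsilon>) powr t)"
      using \<epsilon> by (intro minkowski_rate_greater) (auto simp: G(3))
    obtain h where h: "bij_betw h {..<card G} G"
      using ex_bij_betw_nat_finite[OF G(1)] by (auto simp: lessThan_atLeast0)
    \<comment> \<open>Hausdorff covers are infinite sequences, so the finite cover is padded with
      empty sets, whose gauge is 0.\<close>
    define M where "M i = (if i < card G then qball d (h i) \<epsilon> else {})" for i
    have "S \<subseteq> (\<Union>i. M i)"
    proof
      fix x assume "x \<in> S"
      then obtain y where y: "y \<in> G" "x \<in> qball d y \<epsilon>"
        using G(2) by blast
      moreover from y(1) have "y \<in> h ` {..<card G}"
        by (simp only: bij_betw_imp_surj_on[OF h])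
      then obtain i where "i < card G" "h i = y"
        by auto
      ultimately show "x \<in> (\<Union>i. M i)"
        by (auto simp: M_def)
    qed
    moreover have diam: "qdiam d (M i) \<le> ennreal (2 * k * \<epsilon>)" for i
      using qdiam_qball_le[of "h i" \<epsilon>] by (auto simp: M_def qdiam_def)
    have "2 * k * \<epsilon> \<le> \<delta>"
      using \<epsilon>(4) k_pos by (simp add: field_simps)
    then have "qdiam d (M i) \<le> ennreal \<delta>" for i
      using diam[of i] by (meson ennreal_leI order_trans)
    moreover have "(\<Sum>i. ennreal (exp_gauge s (enn2real (qdiam d (M i))))) \<le> 1"
    proof -
      let ?e = "exp (- ((1 / (2 * k * \<epsilon>)) powr s))"
      have "(1 / (2 * k * \<epsilon>)) powr s = (1 / (2 * k)) powr s * (1 / \<epsilon>) powr s"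
        using k_pos \<epsilon>(2) by (simp flip: powr_mult)
      then have "real (card G) * ?e \<le> 2 powr ((1 / \<epsilon>) powr t) * exp (- (ln 2 * (1 / \<epsilon>) powr t))"
        using card \<epsilon>(5) by (intro mult_mono) auto
      also have "\<dots> = 1"
        by (simp add: powr_def[of 2] mult.commute flip: exp_add)
      finally have e: "real (card G) * ?e \<le> 1" .
      have "(\<Sum>i. ennreal (exp_gauge s (enn2real (qdiam d (M i))))) =
          (\<Sum>i<card G. ennreal (exp_gauge s (enn2real (qdiam d (M i)))))"
        by (intro suminf_finite) (auto simp: M_def qdiam_def exp_gauge_def)
      also have "\<dots> \<le> (\<Sum>i<card G. ennreal ?e)"
        using assms k_pos \<epsilon> diam
        by (intro sum_mono ennreal_leI exp_gauge_le) (auto intro: enn2real_leI)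
      also have "\<dots> = ennreal (real (card G) * ?e)"
        by (simp add: ennreal_mult ennreal_of_nat_eq_real_of_nat)
      also have "\<dots> \<le> ennreal 1"
        using e by (rule ennreal_leI)
      finally show ?thesis
        by simp
    qed
    ultimately show ?thesis
      by (intro exI[of _ M] conjI allI)
  qed
  then obtain M where "S \<subseteq> (\<Union>i. M i)" "\<forall>i::nat. qdiam d (M i) \<le> ennreal \<delta>"
      "(\<Sum>i. ennreal (exp_gauge s (enn2real (qdiam d (M i))))) \<le> 1"
    by blast
  then show "(INF M \<in> {M. S \<subseteq> (\<Union>i. M i) \<and> (\<forall>i. qdiam d (M i) \<le> ennreal \<delta>)}.
        \<Sum>i. ennreal (exp_gauge s (enn2real (qdiam d (M i))))) \<le> 1"
    by (intro INF_lower2[of M]) auto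
qed

lemma hausdorff_dim_exp_le_lower_minkowski_dim_exp:
  assumes "S \<noteq> {}"
  shows "hausdorff_dim_exp d S \<le> lower_minkowski_dim_exp d S"
  unfolding hausdorff_dim_exp_def
proof (rule Sup_least)
  fix x assume "x \<in> insert 0 (ereal ` {s. 0 < s \<and> hausdorff_measure_exp d s S = \<infinity>})"
  then consider "x = 0" | s where "x = ereal s" "0 < s" "hausdorff_measure_exp d s S = \<infinity>"
    by blast
  then show "x \<le> lower_minkowski_dim_exp d S"
  proof cases
    case 1
    then show ?thesis
      using lower_minkowski_dim_exp_nonneg[OF assms] by simp
  next
    case 2
    show ?thesis
    proof (rule ccontr)
      assume "\<not> ?thesis"
      then obtain t where t: "lower_minkowski_dim_exp d S < ereal t" "ereal t < ereal s"
        using 2 ereal_dense2[of "lower_minkowski_dim_exp d S" "ereal s"] by (auto simp: not_le)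
      have "0 < ereal t"
        using lower_minkowski_dim_exp_nonneg[OF assms] t(1) by (rule le_less_trans)
      then have "hausdorff_measure_exp d s S \<le> 1"
        using t 2 assms by (intro hausdorff_measure_exp_le_1[of s t]) auto
      with 2 show False
        by (simp add: top_unique)
    qed
  qed
qed

section \<open>Mass distribution principle and equality of the dimensions\<close>

lemma subset_qball_qdiam:
  assumes "x \<in> M" "qdiam d M \<le> ennreal \<delta>"
  shows "M \<subseteq> qball d x (enn2real (qdiam d M))"
proof
  fix y assume "y \<in> M"
  then have "ennreal (d x y) \<le> qdiam d M"
    unfolding qdiam_def using assms(1) by (intro SUP_upper2[of "(x, y)"]) auto
  \<comment> \<open>Finiteness makes \<open>enn2real\<close> exact; an infinite diameter would be
    sent to 0.\<close>
  moreover have "qdiam d M < \<top>"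
    using assms(2) by (auto simp: less_top[symmetric] top_unique)
  ultimately have "enn2real (ennreal (d x y)) \<le> enn2real (qdiam d M)"
    by (intro enn2real_mono)
  then show "y \<in> qball d x (enn2real (qdiam d M))"
    by (simp add: qball_def nonneg)
qed

text \<open>Because \<open>s < t\<close>, for every constant \<open>B\<close> the sets
  \<open>M\<close> of small enough diameter satisfy
  \<open>B * outer_measure_of \<mu> M \<le> exp_gauge s (diam M)\<close>. Summing over a cover of
  \<open>S\<close> bounds the Hausdorff measure below by \<open>B\<close>, which is
  arbitrary.\<close>

lemma mass_distribution_principle:
  assumes "space \<mu> = UNIV" "outer_measure_of \<mu> S = 1"
    and "0 < s" "s < t" "small_ball_condition d \<mu> t"
  shows "hausdorff_measure_exp d s S = \<infinity>"
proof (rule ccontr)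
  assume "hausdorff_measure_exp d s S \<noteq> \<infinity>"
  then obtain h where h: "0 \<le> h" "hausdorff_measure_exp d s S = ennreal h"
    by (cases "hausdorff_measure_exp d s S") auto
  \<comment> \<open>Any constant above the supposed finite value \<open>h\<close> leads to the
    contradiction.\<close>
  define B where "B = h + 1"
  have "0 < B"
    using h by (simp add: B_def)
  obtain c r0 where c: "0 < c" "0 < r0"
      "\<And>x r. 0 < r \<Longrightarrow> r < r0 \<Longrightarrow> outer_measure_of \<mu> (qball d x r) \<le> ennreal (exp (- c * (1 / r) powr t))"
    using assms(5) unfolding small_ball_condition_def by blast
  \<comment> \<open>One half of \<open>c\<close> pays for the constant \<open>ln B\<close>, written
    with exponent 0; the other half pays for passing from \<open>t\<close> to
    \<open>s\<close>.\<close>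
  have "\<forall>\<^sub>F r in at_right 0. ln B * (1 / r) powr 0 \<le> c / 2 * (1 / r) powr t"
    using assms c by (intro eventually_powr_dominated) auto
  moreover have "\<forall>\<^sub>F r in at_right 0. 1 * (1 / r) powr s \<le> c / 2 * (1 / r) powr t"
    using assms c by (intro eventually_powr_dominated) auto
  ultimately have "\<forall>\<^sub>F r in at_right 0.
      ln B * (1 / r) powr 0 \<le> c / 2 * (1 / r) powr t \<and> 1 * (1 / r) powr s \<le> c / 2 * (1 / r) powr t"
    by (rule eventually_conj)
  then obtain b where b: "0 < b"
      "\<And>r. 0 < r \<Longrightarrow> r < b \<Longrightarrow> ln B * (1 / r) powr 0 \<le> c / 2 * (1 / r) powr t"
      "\<And>r. 0 < r \<Longrightarrow> r < b \<Longrightarrow> (1 / r) powr s \<le> c / 2 * (1 / r) powr t"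
    by (auto simp: eventually_at_right_field)
  define \<delta> where "\<delta> = min b r0 / 2"
  have \<delta>: "0 < \<delta>" "\<delta> < b" "\<delta> < r0"
    using b(1) c(2) by (auto simp: \<delta>_def)
  have ball: "ennreal B * outer_measure_of \<mu> (qball d x r) \<le> ennreal (exp (- ((1 / r) powr s)))"
    if "0 < r" "r \<le> \<delta>" for x r
  proof -
    have "ennreal B * outer_measure_of \<mu> (qball d x r) \<le> ennreal B * ennreal (exp (- c * (1 / r) powr t))"
      using that \<delta> c(3) by (intro mult_left_mono) auto
    also have "\<dots> = ennreal (exp (ln B - c * (1 / r) powr t))"
      using \<open>0 < B\<close> by (simp add: exp_diff exp_minus field_simps flip: ennreal_mult)
    also have "ln B - c * (1 / r) powr t \<le> - ((1 / r) powr s)"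
      using b(2,3)[of r] that \<delta> by simp
    finally show ?thesis
      by (simp add: ennreal_leI)
  qed
  have small: "ennreal B * outer_measure_of \<mu> M \<le> ennreal (exp_gauge s (enn2real (qdiam d M)))"
    if M: "qdiam d M \<le> ennreal \<delta>" for M
  proof (cases "M = {}")
    case False
    then obtain x where "x \<in> M"
      by blast
    let ?\<rho> = "enn2real (qdiam d M)"
    have sub: "M \<subseteq> qball d x ?\<rho>"
      using \<open>x \<in> M\<close> M by (rule subset_qball_qdiam)
    have le: "ennreal B * outer_measure_of \<mu> M \<le> ennreal (exp (- ((1 / r) powr s)))"
      if "0 < r" "r \<le> \<delta>" "?\<rho> \<le> r" for r
    proof -
      have "M \<subseteq> qball d x r"
        using sub that(3) by (auto simp: qball_def)
      then have "ennreal B * outer_measure_of \<mu> M \<le> ennreal B * outer_measure_of \<mu> (qball d x r)"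
        by (intro mult_left_mono outer_measure_of_mono) auto
      also have "\<dots> \<le> ennreal (exp (- ((1 / r) powr s)))"
        using that by (intro ball)
      finally show ?thesis .
    qed
    show ?thesis
    \<comment> \<open>A set of diameter 0 has gauge 0, so its outer measure must vanish. It lies in
      balls of every small radius \<open>r\<close>, and their bound tends to 0 with
      \<open>r\<close>.\<close>
    proof (cases "?\<rho> = 0")
      case True
      have "filterlim (\<lambda>r::real. (1 / r) powr s) at_top (at_right 0)"
        unfolding filterlim_at_top
      proof
        fix Z
        have "\<forall>\<^sub>F r in at_right 0. Z * (1 / r) powr 0 \<le> 1 * (1 / r) powr s"
          using assms(3) by (intro eventually_powr_dominated) auto
        with eventually_at_right_less[of 0] show "\<forall>\<^sub>F r in at_right 0. Z \<le> (1 / r) powr s"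
          by eventually_elim simp
      qed
      then have "((\<lambda>r::real. exp (- ((1 / r) powr s))) \<longlongrightarrow> 0) (at_right 0)"
        by (intro filterlim_compose[OF exp_at_bot] filterlim_compose[OF filterlim_uminus_at_bot_at_top])
      then have "((\<lambda>r::real. ennreal (exp (- ((1 / r) powr s)))) \<longlongrightarrow> ennreal 0) (at_right 0)"
        by (rule tendsto_ennrealI)
      moreover have "\<forall>\<^sub>F r in at_right 0. ennreal B * outer_measure_of \<mu> M \<le> ennreal (exp (- ((1 / r) powr s)))"
        using \<delta>(1) le True by (auto simp: eventually_at_right_field intro!: exI[of _ \<delta>])
      ultimately have "ennreal B * outer_measure_of \<mu> M \<le> ennreal 0"
        by (intro tendsto_lowerbound) auto
      then show ?thesis
        by (rule order_trans) simp
    next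
      case False
      then have "0 < ?\<rho>"
        by (simp add: less_le)
      moreover have "?\<rho> \<le> \<delta>"
        using M \<delta>(1) by (intro enn2real_leI) auto
      ultimately show ?thesis
        using le[of ?\<rho>] by (simp add: exp_gauge_def)
    qed
  next
    case True
    then have "ennreal B * outer_measure_of \<mu> M = 0"
      by (simp add: outer_measure_of_eq[OF sets.empty_sets])
    then show ?thesis
      by (metis zero_le)
  qed
  have "ennreal B \<le> (INF M \<in> {M. S \<subseteq> (\<Union>i. M i) \<and> (\<forall>i. qdiam d (M i) \<le> ennreal \<delta>)}.
        \<Sum>i. ennreal (exp_gauge s (enn2real (qdiam d (M i)))))"
  proof (rule INF_greatest, clarify)
    fix M :: "nat \<Rightarrow> 'a set" assume M: "S \<subseteq> (\<Union>i. M i)" "\<forall>i. qdiam d (M i) \<le> ennreal \<delta>"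
    have "outer_measure_of \<mu> S \<le> outer_measure_of \<mu> (\<Union>i. M i)"
      using M(1) by (rule outer_measure_of_mono)
    also have "\<dots> \<le> (\<Sum>i. outer_measure_of \<mu> (M i))"
      using assms(1) by (intro outer_measure_of_UN_le) auto
    finally have "ennreal B * 1 \<le> ennreal B * (\<Sum>i. outer_measure_of \<mu> (M i))"
      using assms(2) by (intro mult_left_mono) auto
    also have "\<dots> = (\<Sum>i. ennreal B * outer_measure_of \<mu> (M i))"
      by simp
    also have "\<dots> \<le> (\<Sum>i. ennreal (exp_gauge s (enn2real (qdiam d (M i)))))"
      using M(2) by (intro suminf_le small) auto
    finally show "ennreal B \<le> (\<Sum>i. ennreal (exp_gauge s (enn2real (qdiam d (M i)))))"
      by simp
  qed
  also have "\<dots> \<le> hausdorff_measure_exp d s S"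
    unfolding hausdorff_measure_exp_def using \<delta>(1) by (intro SUP_upper) auto
  finally show False
    using h by (simp add: B_def)
qed

text \<open>If the dimensions differed, two exponents \<open>s < t\<close> would fit strictly
  between them. Criticality gives the small-ball condition for \<open>t\<close>, and the mass
  distribution principle then makes the measure for \<open>s\<close> infinite.\<close>

lemma hausdorff_dim_exp_eq_lower_minkowski_dim_exp:
  assumes "S \<noteq> {}" "space \<mu> = UNIV" "outer_measure_of \<mu> S = 1" "critical_measure d S \<mu>"
  shows "hausdorff_dim_exp d S = lower_minkowski_dim_exp d S"
proof (rule antisym[OF hausdorff_dim_exp_le_lower_minkowski_dim_exp[OF assms(1)]], rule ccontr)
  assume "\<not> lower_minkowski_dim_exp d S \<le> hausdorff_dim_exp d S"
  then obtain s where s: "hausdorff_dim_exp d S < ereal s" "ereal s < lower_minkowski_dim_exp d S"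
    using ereal_dense2 by (auto simp: not_le)
  then obtain t where t: "ereal s < ereal t" "ereal t < lower_minkowski_dim_exp d S"
    using ereal_dense2 by blast
  have "0 \<le> hausdorff_dim_exp d S"
    unfolding hausdorff_dim_exp_def by (rule Sup_upper) simp
  then have "0 < ereal s"
    using s(1) by (rule le_less_trans)
  then have "hausdorff_measure_exp d s S = \<infinity>"
    using assms t unfolding critical_measure_def
    by (intro mass_distribution_principle[of \<mu> S s t]) auto
  with \<open>0 < ereal s\<close> have "ereal s \<le> hausdorff_dim_exp d S"
    unfolding hausdorff_dim_exp_def by (intro Sup_upper) auto
  with s(1) show False
    by simp
qed

end

section \<open>Random series\<close>

text \<open>Fubini with the \<open>n\<close>-th factor split off: once the other coordinates are
  frozen, the section of \<open>E\<close> meets the support of \<open>p n\<close> in at most one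
  atom, of mass at most \<open>q\<close>. The remaining factors form a probability space.\<close>

lemma emeasure_PiM_pmf_determined_le:
  fixes p :: "'i \<Rightarrow> 'b pmf"
  assumes E: "E \<in> sets (PiM UNIV (\<lambda>i. measure_pmf (p i)))"
    and determined: "\<And>\<omega> x y. fun_upd \<omega> n x \<in> E \<Longrightarrow> fun_upd \<omega> n y \<in> E \<Longrightarrow>
      x \<in> set_pmf (p n) \<Longrightarrow> y \<in> set_pmf (p n) \<Longrightarrow> x = y"
    and atom: "\<And>x. pmf (p n) x \<le> q"
  shows "emeasure (PiM UNIV (\<lambda>i. measure_pmf (p i))) E \<le> ennreal q"
proof -
  let ?M = "\<lambda>i. measure_pmf (p i)" and ?I = "UNIV - {n}"
  let ?g = "\<lambda>(x, X). fun_upd X n x"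
  interpret R: prob_space "PiM ?I ?M"
    by (intro prob_space_PiM measure_pmf.prob_space_axioms)
  interpret pair_sigma_finite "?M n" "PiM ?I ?M" ..
  have ins: "insert n ?I = UNIV"
    by auto
  have g: "?g \<in> ?M n \<Otimes>\<^sub>M PiM ?I ?M \<rightarrow>\<^sub>M PiM UNIV ?M"
    using measurable_fun_upd[where I = "UNIV" and J = "?I" and i = n and f = snd and h = fst
        and N = "?M n \<Otimes>\<^sub>M PiM ?I ?M" and M = ?M]
    by (auto simp: case_prod_beta')
  have section_le: "emeasure (?M n) {x. fun_upd X n x \<in> E} \<le> ennreal q" for X
  proof -
    have "emeasure (?M n) {x. fun_upd X n x \<in> E} = emeasure (?M n) ({x. fun_upd X n x \<in> E} \<inter> set_pmf (p n))"
      by (simp add: emeasure_Int_set_pmf)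
    also have "\<dots> \<le> ennreal q"
    proof (cases "{x. fun_upd X n x \<in> E} \<inter> set_pmf (p n) = {}")
      case False
      then obtain x where x: "fun_upd X n x \<in> E" "x \<in> set_pmf (p n)"
        by blast
      then have "emeasure (?M n) ({x. fun_upd X n x \<in> E} \<inter> set_pmf (p n)) \<le> emeasure (?M n) {x}"
        using determined by (intro emeasure_mono) auto
      also have "\<dots> \<le> ennreal q"
        using atom by (simp add: emeasure_pmf_single ennreal_leI)
      finally show ?thesis .
    next
      case True
      then show ?thesis
        by (metis emeasure_empty zero_le)
    qed
    finally show ?thesis .
  qed
  have "emeasure (PiM UNIV ?M) E = emeasure (distr (?M n \<Otimes>\<^sub>M PiM ?I ?M) (PiM UNIV ?M) ?g) E"
    using distr_pair_PiM_eq_PiM[of ?I ?M n, OF measure_pmf.prob_space_axioms measure_pmf.prob_space_axioms]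
    by (simp only: ins)
  also have "\<dots> = emeasure (?M n \<Otimes>\<^sub>M PiM ?I ?M) (?g -` E \<inter> space (?M n \<Otimes>\<^sub>M PiM ?I ?M))"
    using g E by (rule emeasure_distr)
  also have "\<dots> = (\<integral>\<^sup>+X. emeasure (?M n) ((\<lambda>x. (x, X)) -` (?g -` E \<inter> space (?M n \<Otimes>\<^sub>M PiM ?I ?M))) \<partial>PiM ?I ?M)"
    using measurable_sets[OF g E] by (rule emeasure_pair_measure_alt2)
  also have "\<dots> \<le> (\<integral>\<^sup>+X. ennreal q \<partial>PiM ?I ?M)"
  proof (rule nn_integral_mono)
    fix X
    have "emeasure (?M n) ((\<lambda>x. (x, X)) -` (?g -` E \<inter> space (?M n \<Otimes>\<^sub>M PiM ?I ?M)))
        \<le> emeasure (?M n) {x. fun_upd X n x \<in> E}"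
      by (intro emeasure_mono) auto
    also note section_le
    finally show "emeasure (?M n) ((\<lambda>x. (x, X)) -` (?g -` E \<inter> space (?M n \<Otimes>\<^sub>M PiM ?I ?M))) \<le> ennreal q" .
  qed
  also have "\<dots> = ennreal q"
    by (simp add: R.emeasure_space_1)
  finally show ?thesis .
qed

text \<open>Such a set is the union of the cylinders contained in it, and over a countable alphabet
  there are only countably many cylinders.\<close>

lemma sets_PiM_pmf_finitely_determined:
  fixes p :: "nat \<Rightarrow> 'b::countable pmf"
  assumes "\<And>\<omega>. \<omega> \<in> A \<Longrightarrow> \<exists>N. \<forall>\<omega>'. (\<forall>i<N. \<omega>' i = \<omega> i) \<longrightarrow> \<omega>' \<in> A"
  shows "A \<in> sets (PiM UNIV (\<lambda>i. measure_pmf (p i)))"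
proof -
  let ?P = "PiM UNIV (\<lambda>i. measure_pmf (p i))"
  define cyl :: "'b list \<Rightarrow> (nat \<Rightarrow> 'b) set" where "cyl w = {\<omega>. \<forall>i<length w. \<omega> i = w ! i}" for w
  have "cyl w \<in> sets ?P" for w
  proof -
    have "{\<omega> \<in> space ?P. \<forall>i\<in>{..<length w}. \<omega> i \<in> {w ! i}} \<in> sets ?P"
      by (intro sets.sets_Collect_finite_All measurable_sets_Collect[of "\<lambda>\<omega>. \<omega> _" _ "measure_pmf (p _)"]) auto
    then show ?thesis
      by (simp add: cyl_def space_PiM PiE_def Ball_def lessThan_def)
  qed
  then have "(\<Union>w\<in>{w. cyl w \<subseteq> A}. cyl w) \<in> sets ?P"
    by (intro sets.countable_UN' countableI_type) auto
  also have "(\<Union>w\<in>{w. cyl w \<subseteq> A}. cyl w) = A"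
  proof (intro equalityI subsetI)
    fix \<omega> assume "\<omega> \<in> A"
    then obtain N where N: "\<And>\<omega>'. \<forall>i<N. \<omega>' i = \<omega> i \<Longrightarrow> \<omega>' \<in> A"
      using assms by blast
    let ?w = "map \<omega> [0..<N]"
    have "cyl ?w \<subseteq> A"
      by (auto simp: cyl_def intro: N)
    moreover have "\<omega> \<in> cyl ?w"
      by (simp add: cyl_def)
    ultimately show "\<omega> \<in> (\<Union>w\<in>{w. cyl w \<subseteq> A}. cyl w)"
      by blast
  qed blast
  finally show ?thesis .
qed

text \<open>Tychonoff's theorem for finite factors; a countable product of discrete spaces is first
  countable, so compactness yields convergent subsequences.\<close>

lemma seq_compact_PiE_finite:
  fixes A :: "nat \<Rightarrow> nat set"
  assumes "\<And>i. finite (A i)"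
  shows "seq_compact (PiE UNIV A)"
proof (rule compact_imp_seq_compact)
  have "compactin (product_topology (\<lambda>_. euclidean) UNIV) (PiE UNIV A)"
    using assms by (auto simp: compactin_PiE intro: finite_imp_compact)
  then show "compact (PiE UNIV A)"
    by (simp add: euclidean_product_topology)
qed

text \<open>As \<open>t / s > 1\<close>, the exponential rate on the right is strictly larger and
  outweighs the polynomial factor, which stems from the coefficients of the series.\<close>

lemma eventually_scale_le_powr:
  fixes L s t \<alpha> :: real
  assumes "0 < L" "0 < s" "s < t"
  shows "\<forall>\<^sub>F n in sequentially. L * real (Suc n) powr \<alpha> * 2 ^ Suc n \<le> 2 powr (real n * t / s)"
proof -
  define \<beta> where "\<beta> = t / s"
  have "1 < \<beta>"
    using assms by (simp add: \<beta>_def)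
  have "\<forall>\<^sub>F n in sequentially. L * real (Suc n) powr \<alpha> * 2 ^ Suc n \<le> 2 powr (real n * \<beta>)"
    using \<open>1 < \<beta>\<close> \<open>0 < L\<close> by real_asymp
  then show ?thesis
    by (simp add: \<beta>_def)
qed

text \<open>Fixes a modulus of concavity and the constants of Condition \<open>(\<zeta>)\<close>.
  Sequences are taken in \<open>S\<close> at index 0 as well, although the sums start at 1, so that
  they are plain functions into \<open>S\<close>.\<close>

locale zeta_set = quasi_normed_space scl qnorm
  for scl :: "'k::real_normed_field \<Rightarrow> 'a::ab_group_add \<Rightarrow> 'a" and qnorm +
  fixes k C \<alpha> :: real and S :: "'a set"
  assumes k_ge_1: "1 \<le> k"
    and qnorm_add_le: "qnorm (x + y) \<le> k * (qnorm x + qnorm y)"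
    and C_pos: "0 < C"
    and \<alpha>_pos: "0 < \<alpha>"
    and series_converges: "\<And>u. (\<And>n. u n \<in> S) \<Longrightarrow> \<exists>l\<in>S. qconverges (qdist qnorm)
        (\<lambda>N. \<Sum>n=1..N. scl (of_real (1 / (C * real n powr \<alpha>))) (u n)) l"
begin

section \<open>The sum of the series as a function of its terms\<close>

lemma qnorm_minus: "qnorm (- x) = qnorm x"
  using qnorm_scale[of "-1" x] by simp

sublocale quasi_metric "qdist qnorm" k
proof
  show "qdist qnorm x y = qdist qnorm y x" for x y
    using qnorm_minus[of "x - y"] by (simp add: qdist_def)
  show "qdist qnorm x z \<le> k * (qdist qnorm x y + qdist qnorm y z)" for x y z
    using qnorm_add_le[of "x - y" "y - z"] by (simp add: qdist_def)
qed (simp_all add: k_ge_1 qdist_def qnorm_nonneg qnorm_eq_0_iff)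

definition partial_sum :: "(nat \<Rightarrow> 'a) \<Rightarrow> nat \<Rightarrow> 'a" where
  "partial_sum x N = (\<Sum>n=1..N. scl (of_real (1 / (C * real n powr \<alpha>))) (x n))"

definition series_limit :: "(nat \<Rightarrow> 'a) \<Rightarrow> 'a" where
  "series_limit x = (SOME l. l \<in> S \<and> qconverges (qdist qnorm) (partial_sum x) l)"

lemma series_limit:
  assumes "\<And>n. x n \<in> S"
  shows "series_limit x \<in> S" "qconverges (qdist qnorm) (partial_sum x) (series_limit x)"
proof -
  have "\<exists>l. l \<in> S \<and> qconverges (qdist qnorm) (partial_sum x) l"
    using series_converges[of x] assms unfolding partial_sum_def[abs_def] by blast
  from someI_ex[OF this]
  show "series_limit x \<in> S" "qconverges (qdist qnorm) (partial_sum x) (series_limit x)"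
    by (simp_all add: series_limit_def)
qed

lemma partial_sum_diff:
  assumes "m \<le> M"
  shows "partial_sum x M - partial_sum x m =
    (\<Sum>n\<in>{m<..M}. scl (of_real (1 / (C * real n powr \<alpha>))) (x n))"
proof -
  have "{1..M} = {1..m} \<union> {m<..M}"
    using assms by auto
  then have "partial_sum x M = partial_sum x m + (\<Sum>n\<in>{m<..M}. scl (of_real (1 / (C * real n powr \<alpha>))) (x n))"
    unfolding partial_sum_def by (simp only:) (intro sum.union_disjoint, auto)
  then show ?thesis
    by simp
qed

text \<open>Otherwise blocks of large sums far out, taken from different sequences, could be glued
  together to a single sequence whose series is not Cauchy.\<close>

lemma partial_sum_uniformly_Cauchy:
  assumes "0 < \<delta>"
  obtains N where "\<And>x m M. (\<And>n. x n \<in> S) \<Longrightarrow> N \<le> m \<Longrightarrow> m \<le> M \<Longrightarrow>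
    qdist qnorm (partial_sum x M) (partial_sum x m) \<le> \<delta>"
proof (rule ccontr)
  assume "\<not> thesis"
  with that have "\<exists>x m M. (\<forall>n. x n \<in> S) \<and> N \<le> m \<and> m \<le> M \<and>
      \<delta> < qdist qnorm (partial_sum x M) (partial_sum x m)" for N
    by (meson not_le)
  then obtain X m M where X: "\<And>N n. X N n \<in> S" and m: "\<And>N::nat. N \<le> m N" "\<And>N. m N \<le> M N"
      and large: "\<And>N. \<delta> < qdist qnorm (partial_sum (X N) (M N)) (partial_sum (X N) (m N))"
    by metis
  have m_less_M: "m N < M N" for N
  proof -
    have "m N \<noteq> M N"
      using large[of N] assms by (metis d_self less_asym)
    then show ?thesis
      using m(2)[of N] by simp
  qed
  \<comment> \<open>Iterating \<open>M\<close> cuts the indices into blocks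
    \<open>{a j<..a (Suc j)}\<close>; the \<open>j\<close>-th one contains the large sum of the
    sequence \<open>X (a j)\<close>, since \<open>a j \<le> m (a j)\<close> and
    \<open>M (a j) = a (Suc j)\<close>.\<close>
  define a where "a j = (M ^^ j) 0" for j
  have a_Suc: "a (Suc j) = M (a j)" for j
    by (simp add: a_def)
  have "a j < a (Suc j)" for j
    using m(1)[of "a j"] m_less_M[of "a j"] by (simp add: a_Suc)
  then have a: "strict_mono a"
    by (rule strict_monoI_Suc)
  \<comment> \<open>The glued sequence: the least such \<open>j\<close> is the block of
    \<open>n\<close>, and \<open>y\<close> copies \<open>X (a j)\<close> there.\<close>
  define y where "y n = X (a (LEAST j. n \<le> a (Suc j))) n" for n
  have y_S: "y n \<in> S" for n
    by (simp add: y_def X)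
  have y_block: "y n = X (a j) n" if "a j < n" "n \<le> a (Suc j)" for j n
  proof -
    have "(LEAST j. n \<le> a (Suc j)) = j"
    proof (rule Least_equality[of _ j])
      fix i assume "n \<le> a (Suc i)"
      with that have "a j < a (Suc i)"
        by simp
      then show "j \<le> i"
        using strict_mono_less[OF a] by simp
    qed (rule that)
    then show ?thesis
      by (simp add: y_def)
  qed
  have block_large: "\<delta> < qdist qnorm (partial_sum y (M (a j))) (partial_sum y (m (a j)))" for j
  proof -
    have "partial_sum y (M (a j)) - partial_sum y (m (a j)) =
        partial_sum (X (a j)) (M (a j)) - partial_sum (X (a j)) (m (a j))"
      unfolding partial_sum_diff[OF m(2)]
      using m(1)[of "a j"] by (intro sum.cong) (auto simp: y_block a_Suc)
    then show ?thesis
      using large[of "a j"] by (simp add: qdist_def)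
  qed
  let ?l = "series_limit y"
  have "\<forall>\<^sub>F n in sequentially. qdist qnorm (partial_sum y n) ?l < \<delta> / (2 * k)"
    using series_limit(2)[of y] y_S assms k_pos unfolding qconverges_def
    by (intro order_tendstoD(2)) auto
  then obtain N where N: "\<And>n. N \<le> n \<Longrightarrow> qdist qnorm (partial_sum y n) ?l < \<delta> / (2 * k)"
    by (auto simp: eventually_sequentially)
  have "N \<le> a N"
    using a by (rule seq_suble)
  then have "N \<le> m (a N)" "N \<le> M (a N)"
    using m(1)[of "a N"] m(2)[of "a N"] by linarith+
  note close = this[THEN N]
  have "qdist qnorm (partial_sum y (M (a N))) (partial_sum y (m (a N))) \<le>
      k * (qdist qnorm (partial_sum y (M (a N))) ?l + qdist qnorm ?l (partial_sum y (m (a N))))"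
    by (rule triangle)
  also have "\<dots> \<le> k * (\<delta> / (2 * k) + \<delta> / (2 * k))"
    using close k_pos by (intro mult_left_mono add_mono) (auto simp: commute[of ?l])
  also have "\<dots> = \<delta>"
    using k_pos by simp
  finally show False
    using block_large[of N] by simp
qed

text \<open>Uniform continuity of the sum for the product topology. The tails after \<open>N\<close>
  are uniformly small, and sequences with the same initial terms share the partial sum up to
  \<open>N\<close>.\<close>

lemma series_limit_close:
  assumes "0 < \<delta>"
  shows "\<exists>N. \<forall>x y. range x \<subseteq> S \<and> range y \<subseteq> S \<and> (\<forall>n<N. x n = y n) \<longrightarrow>
    qdist qnorm (series_limit x) (series_limit y) \<le> \<delta>"
proof -
  \<comment> \<open>Each tail costs \<open>2 * k * \<eta>\<close>, and joining two tails multiplies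
    their sum by \<open>k\<close>, which makes \<open>4 * k * k * \<eta>\<close> in total.\<close>
  define \<eta> where "\<eta> = \<delta> / (4 * k * k)"
  have "0 < \<eta>"
    using assms k_pos by (simp add: \<eta>_def)
  then obtain N where N: "\<And>x m M. (\<And>n. x n \<in> S) \<Longrightarrow> N \<le> m \<Longrightarrow> m \<le> M \<Longrightarrow>
      qdist qnorm (partial_sum x M) (partial_sum x m) \<le> \<eta>"
    by (rule partial_sum_uniformly_Cauchy) blast
  have tail: "qdist qnorm (series_limit x) (partial_sum x N) \<le> 2 * k * \<eta>" if x: "\<And>n. x n \<in> S" for x
  proof -
    have "\<forall>\<^sub>F M in sequentially. qdist qnorm (partial_sum x M) (series_limit x) < \<eta>"
      using series_limit(2)[of x] x \<open>0 < \<eta>\<close> unfolding qconverges_def by (intro order_tendstoD(2)) auto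
    with eventually_ge_at_top[of N]
    have "\<forall>\<^sub>F M in sequentially. N \<le> M \<and> qdist qnorm (partial_sum x M) (series_limit x) < \<eta>"
      by (rule eventually_conj)
    then obtain M where M: "N \<le> M" "qdist qnorm (partial_sum x M) (series_limit x) < \<eta>"
      using eventually_happens'[OF sequentially_bot] by blast
    have "qdist qnorm (series_limit x) (partial_sum x N) \<le>
        k * (qdist qnorm (series_limit x) (partial_sum x M) + qdist qnorm (partial_sum x M) (partial_sum x N))"
      by (rule triangle)
    also have "\<dots> \<le> k * (\<eta> + \<eta>)"
      using M N[OF x order.refl M(1)] k_pos
      by (intro mult_left_mono add_mono) (auto simp: commute[of "series_limit x"])
    finally show ?thesis
      by simp
  qed
  show ?thesis
  \<comment> \<open>The partial sum includes index \<open>N\<close>, so agreement is required below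
    \<open>Suc N\<close>.\<close>
  proof (intro exI[of _ "Suc N"] allI impI)
    fix x y assume "range x \<subseteq> S \<and> range y \<subseteq> S \<and> (\<forall>n<Suc N. x n = y n)"
    then have xy: "x n \<in> S" "y n \<in> S" "n < Suc N \<Longrightarrow> x n = y n" for n
      by auto
    have eq: "partial_sum x N = partial_sum y N"
      unfolding partial_sum_def using xy(3) by (intro sum.cong) auto
    have "qdist qnorm (series_limit x) (series_limit y) \<le>
        k * (qdist qnorm (series_limit x) (partial_sum x N) + qdist qnorm (partial_sum x N) (series_limit y))"
      by (rule triangle)
    also have "\<dots> \<le> k * (2 * k * \<eta> + 2 * k * \<eta>)"
      using tail[of x, OF xy(1)] tail[of y, OF xy(2)] k_pos
      by (intro mult_left_mono add_mono) (auto simp: commute[of _ "series_limit y"] eq)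
    also have "\<dots> = \<delta>"
      using k_pos by (simp add: \<eta>_def)
    finally show "qdist qnorm (series_limit x) (series_limit y) \<le> \<delta>" .
  qed
qed

text \<open>Changing the \<open>n\<close>-th term shifts all partial sums from \<open>n\<close> on
  by the same vector; the quasi-triangle inequality carries the shift over to the limits.\<close>

lemma series_limit_fun_upd_diff:
  assumes x: "\<And>n. x n \<in> S" and "u \<in> S" "v \<in> S" "1 \<le> n"
  shows "series_limit (fun_upd x n u) - series_limit (fun_upd x n v) =
    scl (of_real (1 / (C * real n powr \<alpha>))) (u - v)" (is "?L u - ?L v = ?t")
proof -
  let ?P = "\<lambda>u. partial_sum (fun_upd x n u)"
  have S: "fun_upd x n u i \<in> S" "fun_upd x n v i \<in> S" for i
    using assms by auto
  have diff: "?P u N - ?P v N = ?t" if "n \<le> N" for N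
  proof -
    have "?P u N - ?P v N = (\<Sum>i=1..N. scl (of_real (1 / (C * real i powr \<alpha>))) (fun_upd x n u i - fun_upd x n v i))"
      by (simp only: partial_sum_def sum_subtractf scale_right_diff_distrib)
    also have "\<dots> = (\<Sum>i\<in>{n}. scl (of_real (1 / (C * real i powr \<alpha>))) (fun_upd x n u i - fun_upd x n v i))"
      using assms(4) that by (intro sum.mono_neutral_right) auto
    finally show ?thesis
      by simp
  qed
  have lim: "(\<lambda>N. k * (qdist qnorm (?P u N) (?L u) + qdist qnorm (?P v N) (?L v))) \<longlonglongrightarrow> k * (0 + 0)"
    using series_limit(2)[of "fun_upd x n u", OF S(1)] series_limit(2)[of "fun_upd x n v", OF S(2)]
    unfolding qconverges_def by (intro tendsto_intros)
  have "qnorm (?t - (?L u - ?L v)) \<le> k * (qdist qnorm (?P u N) (?L u) + qdist qnorm (?P v N) (?L v))"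
    if "n \<le> N" for N
  proof -
    have "?t - (?L u - ?L v) = (?P u N - ?L u) + (?L v - ?P v N)"
      unfolding diff[OF that, symmetric] by simp
    then have "qnorm (?t - (?L u - ?L v)) \<le> k * (qdist qnorm (?P u N) (?L u) + qdist qnorm (?L v) (?P v N))"
      unfolding qdist_def by (simp only: qnorm_add_le)
    then show ?thesis
      by (simp only: commute[of "?L v"])
  qed
  then have "qnorm (?t - (?L u - ?L v)) \<le> k * (0 + 0)"
    using lim by (intro LIMSEQ_le_const) auto
  then have "?t - (?L u - ?L v) = 0"
    using qnorm_nonneg[of "?t - (?L u - ?L v)"] by (simp flip: qnorm_eq_0_iff)
  then show ?thesis
    by (simp only: right_minus_eq)
qed

text \<open>In the proof the sets \<open>F n\<close> are enumerated cyclically by all naturals, so that every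
  \<open>nat \<Rightarrow> nat\<close> codes a sequence in \<open>S\<close>.\<close>

lemma obtain_series_law:
  assumes F: "\<And>n. F n \<subseteq> S" "\<And>n. finite (F n)" "\<And>n. F n \<noteq> {}" "\<And>n. separated (\<epsilon> n) (F n)"
  obtains \<mu> where "sets \<mu> = sets (qborel (qdist qnorm))" "prob_space \<mu>"
    "outer_measure_of \<mu> S = 1" "outer_measure_of \<mu> (UNIV - S) = 0"
    "\<And>x r n. 1 \<le> n \<Longrightarrow> 0 < r \<Longrightarrow> 4 * k * k * r * (C * real n powr \<alpha>) \<le> \<epsilon> n \<Longrightarrow>
      outer_measure_of \<mu> (qball (qdist qnorm) x r) \<le> ennreal (1 / real (card (F n)))"
proof -
  let ?d = "qdist qnorm"
  have card_pos: "0 < card (F n)" for n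
    using F(2,3) by (simp add: card_gt_0_iff)
  have "\<exists>h. bij_betw h {..<card (F n)} (F n)" for n
    using ex_bij_betw_nat_finite[OF F(2)] by (simp add: lessThan_atLeast0)
  then obtain h where h: "\<And>n. bij_betw (h n) {..<card (F n)} (F n)"
    by metis
  define X where "X \<omega> n = h n (\<omega> n mod card (F n))" for \<omega> :: "nat \<Rightarrow> nat" and n
  have X_F: "X \<omega> n \<in> F n" for \<omega> n
    using bij_betwE[OF h[of n]] card_pos[of n] by (simp add: X_def)
  then have X_S: "X \<omega> n \<in> S" for \<omega> n
    using F(1) by blast
  define \<Phi> where "\<Phi> \<omega> = series_limit (X \<omega>)" for \<omega>
  have \<Phi>_S: "\<Phi> \<omega> \<in> S" for \<omega>
    unfolding \<Phi>_def by (intro series_limit X_S)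
  have \<Phi>_close: "\<exists>N. \<forall>\<omega> \<omega>'. (\<forall>i<N. \<omega>' i = \<omega> i) \<longrightarrow> ?d (\<Phi> \<omega>) (\<Phi> \<omega>') \<le> \<delta>" if \<delta>: "0 < \<delta>" for \<delta>
  proof -
    obtain N where N: "\<And>x y. range x \<subseteq> S \<and> range y \<subseteq> S \<and> (\<forall>n<N. x n = y n) \<Longrightarrow>
        ?d (series_limit x) (series_limit y) \<le> \<delta>"
      using series_limit_close[OF \<delta>] by metis
    have "?d (\<Phi> \<omega>) (\<Phi> \<omega>') \<le> \<delta>" if "\<forall>i<N. \<omega>' i = \<omega> i" for \<omega> \<omega>'
      unfolding \<Phi>_def using that X_S by (intro N) (auto simp: X_def)
    then show ?thesis
      by blast
  qed
  define p where "p n = pmf_of_set {..<card (F n)}" for n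
  have nonempty: "{..<card (F n)} \<noteq> {}" for n
    using card_pos[of n] by (simp add: lessThan_empty_iff)
  have p: "set_pmf (p n) = {..<card (F n)}" "pmf (p n) i \<le> 1 / real (card (F n))" for n i
    by (simp_all add: p_def set_pmf_of_set pmf_of_set nonempty divide_right_mono indicator_def)
  define P where "P = PiM UNIV (\<lambda>n. measure_pmf (p n))"
  have space_P: "space P = UNIV"
    by (simp add: P_def space_PiM)
  interpret P: prob_space P
    unfolding P_def by (intro prob_space_PiM measure_pmf.prob_space_axioms)
  have \<Phi>_measurable: "\<Phi> \<in> P \<rightarrow>\<^sub>M qborel ?d"
    unfolding qborel_def
  proof (rule measurable_measure_of)
    fix U assume "U \<in> {U. qopen ?d U}"
    then have U: "qopen ?d U"
      by simp
    have "\<Phi> -` U \<in> sets P"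
      unfolding P_def
    proof (rule sets_PiM_pmf_finitely_determined)
      fix \<omega> assume "\<omega> \<in> \<Phi> -` U"
      then obtain r where r: "0 < r" "qball ?d (\<Phi> \<omega>) r \<subseteq> U"
        using U by (auto simp: qopen_def)
      obtain N where "\<And>\<omega>'. \<forall>i<N. \<omega>' i = \<omega> i \<Longrightarrow> ?d (\<Phi> \<omega>) (\<Phi> \<omega>') \<le> r"
        using \<Phi>_close[OF r(1)] by metis
      then have "\<forall>\<omega>'. (\<forall>i<N. \<omega>' i = \<omega> i) \<longrightarrow> \<omega>' \<in> \<Phi> -` U"
        using r(2) by (auto simp: qball_def)
      then show "\<exists>N. \<forall>\<omega>'. (\<forall>i<N. \<omega>' i = \<omega> i) \<longrightarrow> \<omega>' \<in> \<Phi> -` U"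
        by (rule exI)
    qed
    then show "\<Phi> -` U \<inter> space P \<in> sets P"
      by (simp add: space_P)
  qed auto
  define \<mu> where "\<mu> = distr P (qborel ?d) \<Phi>"
  have sets_\<mu>: "sets \<mu> = sets (qborel ?d)"
    by (simp add: \<mu>_def)
  have emeasure_\<mu>: "emeasure \<mu> A = emeasure P (\<Phi> -` A)" if "A \<in> sets (qborel ?d)" for A
    unfolding \<mu>_def using emeasure_distr[OF \<Phi>_measurable that] by (simp add: space_P)
  interpret \<mu>: prob_space \<mu>
    unfolding \<mu>_def using \<Phi>_measurable by (rule P.prob_space_distr)
  have outer_le: "outer_measure_of \<mu> M \<le> emeasure P (\<Phi> -` A)"
    if "A \<in> sets (qborel ?d)" "M \<subseteq> A" for M A
    using outer_measure_of_mono[OF that(2), of \<mu>] that(1) by (simp add: sets_\<mu> emeasure_\<mu>)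
  \<comment> \<open>\<open>S\<close> itself need not be Borel; the closed set
    \<open>range \<Phi>\<close> inside it carries all the mass.\<close>
  have closed: "qopen ?d (- range \<Phi>)"
  proof (rule qopen_Compl_if_seq_closed)
    fix u l assume u: "\<And>n. u n \<in> range \<Phi>" and lim: "qconverges ?d u l"
    have "\<exists>\<omega>. \<omega> \<in> (\<Pi>\<^sub>E n\<in>UNIV. {..<card (F n)}) \<and> u j = \<Phi> \<omega>" for j
    proof -
      obtain \<omega> where \<omega>: "u j = \<Phi> \<omega>"
        using u by blast
      \<comment> \<open>Reducing the codes modulo the cardinalities keeps the value of
        \<open>\<Phi>\<close> and moves them into a compact product.\<close>
      have "X (\<lambda>n. \<omega> n mod card (F n)) = X \<omega>"
        by (simp add: X_def fun_eq_iff)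
      then show ?thesis
        using \<omega> card_pos by (intro exI[of _ "\<lambda>n. \<omega> n mod card (F n)"]) (auto simp: \<Phi>_def)
    qed
    then obtain w where w: "\<And>j. w j \<in> (\<Pi>\<^sub>E n\<in>UNIV. {..<card (F n)})" "\<And>j. u j = \<Phi> (w j)"
      by metis
    have "seq_compact (\<Pi>\<^sub>E n\<in>UNIV. {..<card (F n)})"
      by (rule seq_compact_PiE_finite) simp
    then obtain \<omega> r where r: "strict_mono (r :: nat \<Rightarrow> nat)" "(w \<circ> r) \<longlonglongrightarrow> \<omega>"
      using w(1) by (auto elim!: seq_compactE)
    have "qconverges ?d (u \<circ> r) (\<Phi> \<omega>)"
      unfolding qconverges_def
    proof (rule tendstoI)
      fix \<delta> :: real assume "0 < \<delta>"
      then obtain N where N: "\<And>\<omega> \<omega>'. \<forall>i<N. \<omega>' i = \<omega> i \<Longrightarrow> ?d (\<Phi> \<omega>) (\<Phi> \<omega>') \<le> \<delta> / 2"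
        using \<Phi>_close[of "\<delta> / 2"] by auto
      \<comment> \<open>Convergent coordinates are eventually constant, the naturals being
        discrete.\<close>
      have "\<forall>\<^sub>F j in sequentially. w (r j) i = \<omega> i" for i
        using continuous_on_tendsto_compose[OF continuous_on_product_coordinates[of i] r(2)]
        by (simp add: tendsto_discrete)
      then have "\<forall>\<^sub>F j in sequentially. \<forall>i\<in>{..<N}. \<omega> i = w (r j) i"
        by (intro eventually_ball_finite) (auto simp: eq_commute)
      then show "\<forall>\<^sub>F j in sequentially. dist (?d ((u \<circ> r) j) (\<Phi> \<omega>)) 0 < \<delta>"
      proof eventually_elim
        case (elim j)
        then have "?d (\<Phi> (w (r j))) (\<Phi> \<omega>) \<le> \<delta> / 2"
          by (intro N) auto
        then show ?case
          using \<open>0 < \<delta>\<close> by (simp add: w(2) nonneg)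
      qed
    qed
    moreover have "qconverges ?d (u \<circ> r) l"
      using lim r(1) unfolding qconverges_def by (auto dest: LIMSEQ_subseq_LIMSEQ simp: o_def)
    ultimately have "\<Phi> \<omega> = l"
      by (rule qconverges_unique)
    then show "l \<in> range \<Phi>"
      by blast
  qed
  show ?thesis
  proof (rule that[OF sets_\<mu>])
    show "prob_space \<mu>"
      by (rule \<mu>.prob_space_axioms)
    have "outer_measure_of \<mu> (UNIV - S) \<le> emeasure P (\<Phi> -` (- range \<Phi>))"
      using \<Phi>_S by (intro outer_le qopen_sets_qborel closed) auto
    moreover have "\<Phi> -` (- range \<Phi>) = {}"
      by auto
    ultimately show "outer_measure_of \<mu> (UNIV - S) = 0"
      by simp
    have "1 \<le> outer_measure_of \<mu> S"
      unfolding outer_measure_of_def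
    proof (rule INF_greatest)
      fix A assume "A \<in> {B \<in> sets \<mu>. S \<subseteq> B}"
      then have A: "A \<in> sets (qborel ?d)" "S \<subseteq> A"
        by (auto simp: sets_\<mu>)
      then have "\<Phi> -` A = space P"
        using \<Phi>_S by (auto simp: space_P)
      then show "1 \<le> emeasure \<mu> A"
        using A by (simp add: emeasure_\<mu> P.emeasure_space_1)
    qed
    moreover have "outer_measure_of \<mu> S \<le> 1"
      using outer_le[of UNIV S] sets.top[of "qborel ?d"] P.emeasure_space_1
      by (simp add: space_qborel space_P)
    ultimately show "outer_measure_of \<mu> S = 1"
      by (rule antisym[rotated])
  next
    fix x r and n :: nat assume n: "1 \<le> n" and r: "0 < r" and small: "4 * k * k * r * (C * real n powr \<alpha>) \<le> \<epsilon> n"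
    \<comment> \<open>The Borel hull has radius \<open>2 * k * r\<close>, so two of its points are
      at distance at most \<open>4 * k * k * r\<close>; this is the constant in the hypothesis on
      \<open>r\<close>.\<close>
    obtain A where A: "A \<in> sets (qborel ?d)" "qball ?d x r \<subseteq> A" "A \<subseteq> qball ?d x (2 * k * r)"
      using r by (rule qball_borel_hull)
    have "\<Phi> -` A \<in> sets P"
      using measurable_sets[OF \<Phi>_measurable A(1)] by (simp add: space_P)
    have "emeasure P (\<Phi> -` A) \<le> ennreal (1 / real (card (F n)))"
      unfolding P_def
    proof (rule emeasure_PiM_pmf_determined_le)
      show "\<Phi> -` A \<in> sets (PiM UNIV (\<lambda>n. measure_pmf (p n)))"
        using \<open>\<Phi> -` A \<in> sets P\<close> by (simp add: P_def)
    next
      fix \<omega> i j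
      assume hit: "fun_upd \<omega> n i \<in> \<Phi> -` A" "fun_upd \<omega> n j \<in> \<Phi> -` A" and "i \<in> set_pmf (p n)" "j \<in> set_pmf (p n)"
      then have ij: "i < card (F n)" "j < card (F n)"
        by (auto simp: p)
      then have hF: "h n i \<in> F n" "h n j \<in> F n"
        using bij_betwE[OF h[of n]] by auto
      have X_upd: "X (fun_upd \<omega> n i) = fun_upd (X \<omega>) n (h n i)" "X (fun_upd \<omega> n j) = fun_upd (X \<omega>) n (h n j)"
        using ij by (auto simp: X_def fun_eq_iff)
      have "?d (\<Phi> (fun_upd \<omega> n i)) (\<Phi> (fun_upd \<omega> n j)) \<le>
          k * (?d (\<Phi> (fun_upd \<omega> n i)) x + ?d x (\<Phi> (fun_upd \<omega> n j)))"
        by (rule triangle)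
      also have "\<dots> \<le> k * (2 * k * r + 2 * k * r)"
        using hit A(3) k_pos by (intro mult_left_mono add_mono) (auto simp: qball_def commute[of _ x])
      finally have "?d (\<Phi> (fun_upd \<omega> n i)) (\<Phi> (fun_upd \<omega> n j)) \<le> 4 * k * k * r"
        by simp
      moreover have "?d (\<Phi> (fun_upd \<omega> n i)) (\<Phi> (fun_upd \<omega> n j)) = ?d (h n i) (h n j) / (C * real n powr \<alpha>)"
      proof -
        have "h n i \<in> S" "h n j \<in> S"
          using hF F(1)[of n] by auto
        note diff = series_limit_fun_upd_diff[OF X_S this n]
        show ?thesis
          unfolding \<Phi>_def X_upd qdist_def diff qnorm_scale
          using C_pos by (simp add: norm_divide norm_mult)
      qed
      ultimately have "?d (h n i) (h n j) \<le> 4 * k * k * r * (C * real n powr \<alpha>)"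
        using C_pos n by (simp add: pos_divide_le_eq)
      with small have "\<not> \<epsilon> n < ?d (h n i) (h n j)"
        by simp
      then have "h n i = h n j"
        using F(4)[of n] hF by (auto simp: separated_def)
      then show "i = j"
        using h[of n] ij by (auto simp: bij_betw_def inj_on_def)
    qed (rule p)
    then show "outer_measure_of \<mu> (qball ?d x r) \<le> ennreal (1 / real (card (F n)))"
      using outer_le[OF A(1,2)] by (rule order_trans[rotated])
  qed
qed

text \<open>A small radius \<open>r\<close> is placed between two consecutive critical radii,
  \<open>g (Suc n) \<le> r < g n\<close>. Level \<open>n\<close> bounds the measure by
  \<open>1 / N n\<close>, and \<open>1 / r \<le> 1 / g (Suc n)\<close> is at most
  \<open>2 powr (n * t / s)\<close>, so that \<open>(1 / r) powr s\<close> stays below the exponent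
  in the growth of \<open>N n\<close>.\<close>

lemma small_ball_conditionI:
  assumes card: "\<forall>\<^sub>F n in sequentially. 2 powr (2 powr (real n * t)) \<le> N n"
    and st: "0 < s" "s < t"
    and bound: "\<And>x r n. 1 \<le> n \<Longrightarrow> 0 < r \<Longrightarrow> 4 * k * k * r * (C * real n powr \<alpha>) \<le> (1/2) ^ n \<Longrightarrow>
      outer_measure_of \<mu> (qball (qdist qnorm) x r) \<le> ennreal (1 / N n)"
  shows "small_ball_condition (qdist qnorm) \<mu> s"
proof -
  define L where "L = 4 * k * k * C"
  have "0 < L"
    using k_pos C_pos by (simp add: L_def)
  \<comment> \<open>For \<open>n \<ge> 1\<close>, the largest radius to which \<open>bound\<close>
    applies at level \<open>n\<close>.\<close>
  define g where "g n = (1/2) ^ n / (L * real n powr \<alpha>)" for n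
  have "\<forall>\<^sub>F n in sequentially. 2 powr (2 powr (real n * t)) \<le> N n \<and>
      L * real (Suc n) powr \<alpha> * 2 ^ Suc n \<le> 2 powr (real n * t / s) \<and> 1 \<le> n"
    using card eventually_scale_le_powr[OF \<open>0 < L\<close> st] eventually_ge_at_top by (intro eventually_conj)
  then obtain n0 where n0: "\<And>n. n0 \<le> n \<Longrightarrow> 2 powr (2 powr (real n * t)) \<le> N n"
      "\<And>n. n0 \<le> n \<Longrightarrow> L * real (Suc n) powr \<alpha> * 2 ^ Suc n \<le> 2 powr (real n * t / s)" "1 \<le> n0"
    by (auto simp: eventually_sequentially)
  have "outer_measure_of \<mu> (qball (qdist qnorm) x r) \<le> ennreal (exp (- ln 2 * (1 / r) powr s))"
    if r: "0 < r" "r < g n0" for x r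
  proof -
    have "\<exists>m. g m \<le> r \<and> n0 < m"
    proof -
      obtain m where "(1/2) ^ m < L * r"
        using real_arch_pow_inv[of "L * r" "1/2"] r \<open>0 < L\<close> by auto
      define m' where "m' = max m (Suc n0)"
      have "(1/2) ^ m' \<le> (1/2 :: real) ^ m"
        by (intro power_decreasing) (auto simp: m'_def)
      then have "(1/2) ^ m' < L * r"
        using \<open>(1/2) ^ m < L * r\<close> by (rule le_less_trans)
      then have "(1/2) ^ m' / L \<le> r"
        using \<open>0 < L\<close> by (simp add: pos_divide_le_eq mult.commute)
      moreover have "g m' \<le> (1/2) ^ m' / L"
        unfolding g_def using \<open>0 < L\<close> \<alpha>_pos
        by (intro divide_left_mono) (auto simp: m'_def intro!: ge_one_powr_ge_zero)
      ultimately show ?thesis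
        by (intro exI[of _ m']) (auto simp: m'_def)
    qed
    from LeastI_ex[OF this] have m: "g (LEAST m. g m \<le> r \<and> n0 < m) \<le> r" "n0 < (LEAST m. g m \<le> r \<and> n0 < m)"
      by auto
    \<comment> \<open>The predecessor of the least index above \<open>n0\<close> with
      \<open>g m \<le> r\<close>. It satisfies \<open>r < g n\<close> by leastness, or by the choice
      of \<open>r\<close> when it equals \<open>n0\<close>.\<close>
    define n where "n = (LEAST m. g m \<le> r \<and> n0 < m) - 1"
    have Suc_n: "Suc n = (LEAST m. g m \<le> r \<and> n0 < m)" and "n0 \<le> n"
      using m(2) by (auto simp: n_def)
    have g_Suc: "g (Suc n) \<le> r"
      using m(1) by (simp only: Suc_n)
    have "\<not> (g n \<le> r \<and> n0 < n)"
      using not_less_Least[of n "\<lambda>m. g m \<le> r \<and> n0 < m"] Suc_n by simp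
    then have "r < g n"
      using \<open>n0 \<le> n\<close> r(2) by (cases "n = n0") auto
    have "1 \<le> n"
      using n0(3) \<open>n0 \<le> n\<close> by simp
    have pos: "0 < L * real n powr \<alpha>" "0 < L * real (Suc n) powr \<alpha>"
      using \<open>0 < L\<close> \<open>1 \<le> n\<close> by auto
    have "4 * k * k * r * (C * real n powr \<alpha>) = r * (L * real n powr \<alpha>)"
      by (simp add: L_def)
    also have "\<dots> \<le> (1/2) ^ n"
      using \<open>r < g n\<close> pos(1) by (simp add: g_def pos_less_divide_eq)
    finally have "outer_measure_of \<mu> (qball (qdist qnorm) x r) \<le> ennreal (1 / N n)"
      using \<open>1 \<le> n\<close> r(1) by (intro bound)
    also have "1 / N n \<le> exp (- ln 2 * (1 / r) powr s)"
    proof -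
      have "(1/2) ^ Suc n \<le> r * (L * real (Suc n) powr \<alpha>)"
        using g_Suc pos(2) unfolding g_def by (simp only: pos_divide_le_eq)
      then have "1 / r \<le> L * real (Suc n) powr \<alpha> * 2 ^ Suc n"
        using r(1) by (simp add: field_simps power_one_over)
      also have "\<dots> \<le> 2 powr (real n * t / s)"
        using \<open>n0 \<le> n\<close> by (rule n0(2))
      finally have "(1 / r) powr s \<le> (2 powr (real n * t / s)) powr s"
        using r(1) st(1) by (intro powr_mono2) auto
      also have "\<dots> = 2 powr (real n * t)"
        using st(1) by (simp add: powr_powr)
      finally have "2 powr ((1 / r) powr s) \<le> 2 powr (2 powr (real n * t))"
        by simp
      also have "\<dots> \<le> N n"
        using \<open>n0 \<le> n\<close> by (rule n0(1))
      finally have "1 / N n \<le> 1 / 2 powr ((1 / r) powr s)"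
        by (intro divide_left_mono mult_pos_pos) (auto intro: less_le_trans[of _ "2 powr _"])
      also have "\<dots> = exp (- ln 2 * (1 / r) powr s)"
        by (simp add: powr_def[of 2] exp_minus inverse_eq_divide mult.commute)
      finally show ?thesis .
    qed
    finally show ?thesis
      by (simp add: ennreal_leI)
  qed
  moreover have "0 < g n0"
    using \<open>0 < L\<close> n0(3) by (simp add: g_def)
  moreover have "(0::real) < ln 2"
    by simp
  ultimately show ?thesis
    unfolding small_ball_condition_def by blast
qed

lemma exists_critical_measure:
  assumes "S \<noteq> {}"
  shows "\<exists>\<mu>. sets \<mu> = sets (qborel (qdist qnorm)) \<and> prob_space \<mu> \<and>
    critical_measure (qdist qnorm) S \<mu> \<and>
    outer_measure_of \<mu> (UNIV - S) = 0 \<and> outer_measure_of \<mu> S = 1"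
proof -
  obtain F where F: "\<And>n. F n \<subseteq> S" "\<And>n. finite (F n)" "\<And>n. F n \<noteq> {}"
      "\<And>n. separated ((1/2) ^ n) (F n)"
      "\<And>n. S \<subseteq> (\<Union>x\<in>F n. qball (qdist qnorm) x ((1/2) ^ n)) \<or> 2 ^ 2 ^ n\<^sup>2 \<le> card (F n)"
    using assms by (rule separated_sequence) blast
  obtain \<mu> where \<mu>: "sets \<mu> = sets (qborel (qdist qnorm))" "prob_space \<mu>"
    "outer_measure_of \<mu> S = 1" "outer_measure_of \<mu> (UNIV - S) = 0"
    "\<And>x r n. 1 \<le> n \<Longrightarrow> 0 < r \<Longrightarrow> 4 * k * k * r * (C * real n powr \<alpha>) \<le> (1/2) ^ n \<Longrightarrow>
      outer_measure_of \<mu> (qball (qdist qnorm) x r) \<le> ennreal (1 / real (card (F n)))"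
    by (rule obtain_series_law[where F = F and \<epsilon> = "\<lambda>n. (1/2) ^ n", OF F(1-4)]) blast
  have "small_ball_condition (qdist qnorm) \<mu> s"
    if "0 < s" "ereal s < lower_minkowski_dim_exp (qdist qnorm) S" for s
  proof -
    \<comment> \<open>The intermediate exponent leaves the gap that absorbs the coefficients of the
      series.\<close>
    obtain t where t: "ereal s < ereal t" "ereal t < lower_minkowski_dim_exp (qdist qnorm) S"
      using ereal_dense2[OF \<open>ereal s < _\<close>] by blast
    then have "\<forall>\<^sub>F n in sequentially. 2 powr (2 powr (real n * t)) \<le> real (card (F n))"
      using that(1) F by (intro separated_sequence_card[OF assms]) auto
    then show ?thesis
      using that(1) t(1) \<mu>(5) by (intro small_ball_conditionI) auto
  qed
  then have "critical_measure (qdist qnorm) S \<mu>"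
    using \<mu>(3) by (simp add: critical_measure_def)
  with \<mu> show ?thesis
    by blast
qed

end

theorem theorem1p8:
  fixes scl :: "'k::real_normed_field \<Rightarrow> 'a::ab_group_add \<Rightarrow> 'a"
    and qnorm :: "'a \<Rightarrow> real"
    and S :: "'a set"
  assumes "quasi_banach_space scl qnorm"
    and "S \<noteq> {}"
    and "condition_zeta scl qnorm S"
  shows "(\<exists>\<mu> :: 'a measure.
            sets \<mu> = sets (qborel (qdist qnorm)) \<and> prob_space \<mu> \<and>
            critical_measure (qdist qnorm) S \<mu> \<and>
            outer_measure_of \<mu> (UNIV - S) = 0 \<and>
            outer_measure_of \<mu> S = 1) \<and>
         hausdorff_dim_exp (qdist qnorm) S = lower_minkowski_dim_exp (qdist qnorm) S"
proof -
  interpret quasi_banach_space scl qnorm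
    by fact
  obtain k where k: "1 \<le> k" "\<And>x y. qnorm (x + y) \<le> k * (qnorm x + qnorm y)"
    using qnorm_quasi_triangle by blast
  obtain C \<alpha> where C: "0 < C" "0 < \<alpha>"
      "\<And>x. \<forall>n\<ge>1. x n \<in> S \<Longrightarrow> \<exists>l\<in>S. qconverges (qdist qnorm)
        (\<lambda>N. \<Sum>n=1..N. scl (of_real (1 / (C * real n powr \<alpha>))) (x n)) l"
    using assms(3) unfolding condition_zeta_def by blast
  interpret zeta_set scl qnorm k C \<alpha> S
    using k C by unfold_locales auto
  obtain \<mu> where \<mu>: "sets \<mu> = sets (qborel (qdist qnorm))" "prob_space \<mu>"
      "critical_measure (qdist qnorm) S \<mu>"
      "outer_measure_of \<mu> (UNIV - S) = 0" "outer_measure_of \<mu> S = 1"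
    using exists_critical_measure[OF assms(2)] by blast
  have "space \<mu> = UNIV"
    using sets_eq_imp_space_eq[OF \<mu>(1)] by (simp add: space_qborel)
  then have "hausdorff_dim_exp (qdist qnorm) S = lower_minkowski_dim_exp (qdist qnorm) S"
    using assms(2) \<mu> by (intro hausdorff_dim_exp_eq_lower_minkowski_dim_exp)
  with \<mu> show ?thesis
    by blast
qed
end
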